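(* The coproduct $\Delta$ on $\mathbf{FQSym}^{(l)}$ is an algebra homomorphism $\mathbf{FQSym}^{(l)}\to \mathbf{FQSym}^{(l)}\otimes\mathbf{FQSym}^{(l)}$, so that $\mathbf{FQSym}^{(l)}$ is a graded bialgebra. Moreover, it is a Hopf algebra.
   Context: Fix an integer $l\ge1$ and a set of colors $C$ with $l$ elements. A colored permutation of size $n\ge0$ is a pair $(\sigma,u)$ with $\sigma\in\mathfrak S_n$, $u\in C^n$ (permutations are written as words $\sigma(1)\cdots\sigma(n)$; color words are indexed by positions). The standardization $\mathrm{Std}(v)$ of a word $v$ over the positive integers is the permutation obtained by numbering $1,2,\dots$ the occurrences of the smallest letter of $v$ from left to right, then the occurrences of the next smallest letter, and so on. $\mathbf{FQSym}^{(l)}$ is the $\mathbb C$-vector space with basis $(\mathbf G_{\sigma,u})$ indexed by all colored permutations, graded by size. It is realized as a subalgebra of noncommutative formal series of bounded degree over the alphabet $A=\{1,2,3,\dots\}\times C$ by $$\mathbf G_{\sigma,u}=\sum_{(v,u):\ v\in\{1,2,\dots\}^n,\ \mathrm{Std}(v)=\sigma}(v,u),$$ where the word $(v_1,u_1)\cdots(v_n,u_n)$ over $A$ is written $(v,u)$. Its product is $$\mathbf G_{\sigma',u'}\mathbf G_{\sigma'',u''}=\sum_{\sigma\in\sigma'*\sigma''}\mathbf G_{\sigma,u'\cdot u''},$$ where $u'\cdot u''$ is concatenation and $\sigma'*\sigma''$ is the set of permutations $\tau$ of size $|\sigma'|+|\sigma''|$ such that the first $|\sigma'|$ letters of $\tau$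 standardize to $\sigma'$ and the remaining letters standardize to $\sigma''$. The unit is $1=\mathbf G_{\emptyset,\emptyset}$. The coproduct is the linear map defined by $$\Delta\mathbf G_{\sigma,u}=\sum_{i=0}^n\mathbf G_{(\sigma,u)_{[1,i]}}\otimes\mathbf G_{(\sigma,u)_{[i+1,n]}},$$ where $n$ is the size of $\sigma$ and $(\sigma,u)_{[a,b]}=(\mathrm{Std}(\sigma'),u')$ with $\sigma'$ the subword of $\sigma$ consisting of the letters (values) belonging to the interval $[a,b]$ and $u'$ the subword of $u$ at the same positions. The counit is the projection onto the degree $0$ component. *)

theory Defs
  imports Complex_Main "HOL-Library.Poly_Mapping" "HOL-Combinatorics.Multiset_Permutations"
begin

section \<open>Complex vector spaces with a chosen basis\<close>

text \<open>
  The complex vector space with basis \<open>'a\<close> is the type \<^typ>\<open>'a \<Rightarrow>\<^sub>0 complex\<close> of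
  finitely supported families. Accordingly, the tensor product of the spaces with bases
  \<open>'a\<close> and \<open>'b\<close> is the space with basis \<^typ>\<open>'a \<times> 'b\<close>.
\<close>

definition smult :: "complex \<Rightarrow> ('a \<Rightarrow>\<^sub>0 complex) \<Rightarrow> ('a \<Rightarrow>\<^sub>0 complex)" where
  "smult c p = Poly_Mapping.map ((*) c) p"

definition basis :: "'a \<Rightarrow> ('a \<Rightarrow>\<^sub>0 complex)" where
  "basis a = Poly_Mapping.single a 1"

abbreviation clinear :: "(('a \<Rightarrow>\<^sub>0 complex) \<Rightarrow> ('b \<Rightarrow>\<^sub>0 complex)) \<Rightarrow> bool" where
  "clinear f \<equiv> Vector_Spaces.linear smult smult f"

abbreviation clinear_form :: "(('a \<Rightarrow>\<^sub>0 complex) \<Rightarrow> complex) \<Rightarrow> bool" where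
  "clinear_form f \<equiv> Vector_Spaces.linear smult (*) f"

definition linext :: "('a \<Rightarrow> ('b \<Rightarrow>\<^sub>0 complex)) \<Rightarrow> ('a \<Rightarrow>\<^sub>0 complex) \<Rightarrow> ('b \<Rightarrow>\<^sub>0 complex)" where
  "linext f p = (\<Sum>a\<in>Poly_Mapping.keys p. smult (Poly_Mapping.lookup p a) (f a))"

definition tensor :: "('a \<Rightarrow>\<^sub>0 complex) \<Rightarrow> ('b \<Rightarrow>\<^sub>0 complex) \<Rightarrow> ('a \<times> 'b \<Rightarrow>\<^sub>0 complex)"
    (infixr "\<otimes>" 75) where
  "p \<otimes> q = linext (\<lambda>a. linext (\<lambda>b. basis (a, b)) q) p"

definition tensor_map ::
    "(('a \<Rightarrow>\<^sub>0 complex) \<Rightarrow> ('b \<Rightarrow>\<^sub>0 complex)) \<Rightarrow> (('c \<Rightarrow>\<^sub>0 complex) \<Rightarrow> ('d \<Rightarrow>\<^sub>0 complex)) \<Rightarrow>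
     ('a \<times> 'c \<Rightarrow>\<^sub>0 complex) \<Rightarrow> ('b \<times> 'd \<Rightarrow>\<^sub>0 complex)" where
  "tensor_map f g = linext (\<lambda>(a, c). f (basis a) \<otimes> g (basis c))"

definition tensor_assoc ::
    "(('a \<times> 'b) \<times> 'c \<Rightarrow>\<^sub>0 complex) \<Rightarrow> ('a \<times> ('b \<times> 'c) \<Rightarrow>\<^sub>0 complex)" where
  "tensor_assoc = linext (\<lambda>((a, b), c). basis (a, (b, c)))"

definition lunit_map ::
    "(('a \<Rightarrow>\<^sub>0 complex) \<Rightarrow> complex) \<Rightarrow> ('a \<times> 'b \<Rightarrow>\<^sub>0 complex) \<Rightarrow> ('b \<Rightarrow>\<^sub>0 complex)" where
  "lunit_map \<epsilon> = linext (\<lambda>(a, b). smult (\<epsilon> (basis a)) (basis b))"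
  \<comment> \<open>\<open>\<epsilon> \<otimes> id\<close>, followed by the identification of \<open>\<complex> \<otimes> W\<close> with \<open>W\<close>\<close>

definition runit_map ::
    "(('b \<Rightarrow>\<^sub>0 complex) \<Rightarrow> complex) \<Rightarrow> ('a \<times> 'b \<Rightarrow>\<^sub>0 complex) \<Rightarrow> ('a \<Rightarrow>\<^sub>0 complex)" where
  "runit_map \<epsilon> = linext (\<lambda>(a, b). smult (\<epsilon> (basis b)) (basis a))"


section \<open>Bialgebras and Hopf algebras\<close>

locale unital_algebra =
  fixes mul :: "('a \<Rightarrow>\<^sub>0 complex) \<Rightarrow> ('a \<Rightarrow>\<^sub>0 complex) \<Rightarrow> ('a \<Rightarrow>\<^sub>0 complex)"
    and unit :: "'a \<Rightarrow>\<^sub>0 complex"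
  assumes mul_linear_left: "\<And>y. clinear (\<lambda>x. mul x y)"
    and mul_linear_right: "\<And>x. clinear (\<lambda>y. mul x y)"
    and mul_assoc: "\<And>x y z. mul (mul x y) z = mul x (mul y z)"
    and mul_unit_left: "\<And>x. mul unit x = x"
    and mul_unit_right: "\<And>x. mul x unit = x"

definition mul_map ::
    "(('a \<Rightarrow>\<^sub>0 complex) \<Rightarrow> ('a \<Rightarrow>\<^sub>0 complex) \<Rightarrow> ('a \<Rightarrow>\<^sub>0 complex)) \<Rightarrow>
     ('a \<times> 'a \<Rightarrow>\<^sub>0 complex) \<Rightarrow> ('a \<Rightarrow>\<^sub>0 complex)" where
  "mul_map mul = linext (\<lambda>(a, b). mul (basis a) (basis b))"

text \<open>The product of the tensor product algebra: \<open>(a \<otimes> b) (c \<otimes> d) = ac \<otimes> bd\<close>.\<close>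

definition tensor_mul ::
    "(('a \<Rightarrow>\<^sub>0 complex) \<Rightarrow> ('a \<Rightarrow>\<^sub>0 complex) \<Rightarrow> ('a \<Rightarrow>\<^sub>0 complex)) \<Rightarrow>
     (('b \<Rightarrow>\<^sub>0 complex) \<Rightarrow> ('b \<Rightarrow>\<^sub>0 complex) \<Rightarrow> ('b \<Rightarrow>\<^sub>0 complex)) \<Rightarrow>
     ('a \<times> 'b \<Rightarrow>\<^sub>0 complex) \<Rightarrow> ('a \<times> 'b \<Rightarrow>\<^sub>0 complex) \<Rightarrow> ('a \<times> 'b \<Rightarrow>\<^sub>0 complex)" where
  "tensor_mul mul1 mul2 p q =
     linext (\<lambda>(a, b). linext (\<lambda>(c, d).
       mul1 (basis a) (basis c) \<otimes> mul2 (basis b) (basis d)) q) p"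

locale algebra_hom =
  A: unital_algebra mulA unitA + B: unital_algebra mulB unitB
  for mulA :: "('a \<Rightarrow>\<^sub>0 complex) \<Rightarrow> ('a \<Rightarrow>\<^sub>0 complex) \<Rightarrow> ('a \<Rightarrow>\<^sub>0 complex)"
    and unitA :: "'a \<Rightarrow>\<^sub>0 complex"
    and mulB :: "('b \<Rightarrow>\<^sub>0 complex) \<Rightarrow> ('b \<Rightarrow>\<^sub>0 complex) \<Rightarrow> ('b \<Rightarrow>\<^sub>0 complex)"
    and unitB :: "'b \<Rightarrow>\<^sub>0 complex" +
  fixes f :: "('a \<Rightarrow>\<^sub>0 complex) \<Rightarrow> ('b \<Rightarrow>\<^sub>0 complex)"
  assumes hom_linear: "clinear f"
    and hom_mul: "\<And>x y. f (mulA x y) = mulB (f x) (f y)"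
    and hom_unit: "f unitA = unitB"

locale counital_coalgebra =
  fixes comul :: "('a \<Rightarrow>\<^sub>0 complex) \<Rightarrow> ('a \<times> 'a \<Rightarrow>\<^sub>0 complex)"
    and counit :: "('a \<Rightarrow>\<^sub>0 complex) \<Rightarrow> complex"
  assumes comul_linear: "clinear comul"
    and counit_linear: "clinear_form counit"
    and comul_coassoc:
      "\<And>x. tensor_assoc (tensor_map comul id (comul x)) = tensor_map id comul (comul x)"
    and comul_counit_left: "\<And>x. lunit_map counit (comul x) = x"
    and comul_counit_right: "\<And>x. runit_map counit (comul x) = x"

locale bialgebra =
  unital_algebra mul unit + counital_coalgebra comul counit +
  comul: algebra_hom mul unit "tensor_mul mul mul" "unit \<otimes> unit" comul
  for mul :: "('a \<Rightarrow>\<^sub>0 complex) \<Rightarrow> ('a \<Rightarrow>\<^sub>0 complex) \<Rightarrow> ('a \<Rightarrow>\<^sub>0 complex)"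
    and unit :: "'a \<Rightarrow>\<^sub>0 complex"
    and comul :: "('a \<Rightarrow>\<^sub>0 complex) \<Rightarrow> ('a \<times> 'a \<Rightarrow>\<^sub>0 complex)"
    and counit :: "('a \<Rightarrow>\<^sub>0 complex) \<Rightarrow> complex" +
  assumes counit_mul: "\<And>x y. counit (mul x y) = counit x * counit y"
    and counit_unit: "counit unit = 1"

locale graded_bialgebra =
  bialgebra mul unit comul counit
  for mul :: "('a \<Rightarrow>\<^sub>0 complex) \<Rightarrow> ('a \<Rightarrow>\<^sub>0 complex) \<Rightarrow> ('a \<Rightarrow>\<^sub>0 complex)"
    and unit :: "'a \<Rightarrow>\<^sub>0 complex"
    and comul :: "('a \<Rightarrow>\<^sub>0 complex) \<Rightarrow> ('a \<times> 'a \<Rightarrow>\<^sub>0 complex)"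
    and counit :: "('a \<Rightarrow>\<^sub>0 complex) \<Rightarrow> complex" +
  fixes grade :: "nat \<Rightarrow> ('a \<Rightarrow>\<^sub>0 complex) set"
  assumes grade_subspace: "\<And>n. module.subspace smult (grade n)"
    and grade_direct_sum:
      "\<And>x. \<exists>!f. (\<forall>n. f n \<in> grade n) \<and> finite {n. f n \<noteq> 0} \<and> x = (\<Sum>n | f n \<noteq> 0. f n)"
    and grade_unit: "unit \<in> grade 0"
    and grade_mul: "\<And>m n x y. x \<in> grade m \<Longrightarrow> y \<in> grade n \<Longrightarrow> mul x y \<in> grade (m + n)"
    and grade_comul: "\<And>n x. x \<in> grade n \<Longrightarrow>
      comul x \<in> module.span smult {y \<otimes> z |y z. \<exists>i j. i + j = n \<and> y \<in> grade i \<and> z \<in> grade j}"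
    and grade_counit: "\<And>n x. n > 0 \<Longrightarrow> x \<in> grade n \<Longrightarrow> counit x = 0"

locale hopf_algebra =
  bialgebra mul unit comul counit
  for mul :: "('a \<Rightarrow>\<^sub>0 complex) \<Rightarrow> ('a \<Rightarrow>\<^sub>0 complex) \<Rightarrow> ('a \<Rightarrow>\<^sub>0 complex)"
    and unit :: "'a \<Rightarrow>\<^sub>0 complex"
    and comul :: "('a \<Rightarrow>\<^sub>0 complex) \<Rightarrow> ('a \<times> 'a \<Rightarrow>\<^sub>0 complex)"
    and counit :: "('a \<Rightarrow>\<^sub>0 complex) \<Rightarrow> complex" +
  assumes antipode_exists:
    "\<exists>S. clinear S \<and>
       (\<forall>x. mul_map mul (tensor_map S id (comul x)) = smult (counit x) unit) \<and>
       (\<forall>x. mul_map mul (tensor_map id S (comul x)) = smult (counit x) unit)"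


section \<open>Standardization and colored permutations\<close>

text \<open>
  The number received by the letter at position \<open>i\<close> is the number of positions that are
  numbered no later than \<open>i\<close>: those carrying a smaller letter, and those
  carrying the same letter weakly to the left of \<open>i\<close>.
\<close>

definition std :: "nat list \<Rightarrow> nat list" where
  "std v = map (\<lambda>i. card {j. j < length v \<and> (v ! j < v ! i \<or> v ! j = v ! i \<and> j \<le> i)})
             [0..<length v]"

lemma length_std [simp]: "length (std v) = length v"
  by (simp add: std_def)

lemma std_nth:
  "i < length v \<Longrightarrow>
   std v ! i = card {j. j < length v \<and> (v ! j < v ! i \<or> v ! j = v ! i \<and> j \<le> i)}"
  by (simp add: std_def)

lemma std_nth_le_iff:
  assumes "i < length v" "k < length v"
  shows "std v ! i \<le> std v ! k \<longleftrightarrow> v ! i < v ! k \<or> v ! i = v ! k \<and> i \<le> k"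
proof
  let ?S = "\<lambda>i. {j. j < length v \<and> (v ! j < v ! i \<or> v ! j = v ! i \<and> j \<le> i)}"
  assume le: "std v ! i \<le> std v ! k"
  show "v ! i < v ! k \<or> v ! i = v ! k \<and> i \<le> k"
  proof (rule ccontr)
    assume "\<not> ?thesis"
    hence lt: "v ! k < v ! i \<or> v ! k = v ! i \<and> k < i" by linarith
    have "?S k \<subseteq> ?S i"
    proof
      fix j assume "j \<in> ?S k"
      thus "j \<in> ?S i" using lt unfolding mem_Collect_eq by linarith
    qed
    moreover have "i \<in> ?S i" using assms by simp
    moreover have "i \<notin> ?S k" using lt unfolding mem_Collect_eq by linarith
    ultimately have "?S k \<subset> ?S i" by blast
    hence "card (?S k) < card (?S i)" by (intro psubset_card_mono) auto
    with le assms show False by (simp add: std_nth)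
  qed
next
  assume "v ! i < v ! k \<or> v ! i = v ! k \<and> i \<le> k"
  thus "std v ! i \<le> std v ! k" using assms
    by (auto simp: std_nth intro!: card_mono)
qed

lemma std_permutation: "std v \<in> permutations_of_set {1..length v}"
proof -
  have d: "distinct (std v)"
    unfolding distinct_conv_nth
  proof (intro allI impI)
    fix i j assume "i < length (std v)" "j < length (std v)" "i \<noteq> j"
    thus "std v ! i \<noteq> std v ! j"
      using std_nth_le_iff[of i v j] std_nth_le_iff[of j v i] by auto
  qed
  have "set (std v) \<subseteq> {1..length v}"
  proof
    fix x assume "x \<in> set (std v)"
    then obtain i where i: "i < length v" and x: "x = std v ! i"
      by (auto simp: in_set_conv_nth)
    let ?S = "{j. j < length v \<and> (v ! j < v ! i \<or> v ! j = v ! i \<and> j \<le> i)}"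
    have "card {i} \<le> card ?S" using i by (intro card_mono) auto
    moreover have "card ?S \<le> card {..<length v}" by (intro card_mono) auto
    ultimately show "x \<in> {1..length v}" using i by (simp add: x std_nth)
  qed
  moreover have "card (set (std v)) = card {1..length v}"
    using d by (simp add: distinct_card)
  ultimately have "set (std v) = {1..length v}" by (intro card_subset_eq) auto
  with d show ?thesis by (auto simp: permutations_of_set_def)
qed

typedef 'c cperm = "{(\<sigma>, u :: 'c list). \<sigma> \<in> permutations_of_set {1..length \<sigma>} \<and> length u = length \<sigma>}"
proof
  show "([], []) \<in> {(\<sigma>, u :: 'c list). \<sigma> \<in> permutations_of_set {1..length \<sigma>} \<and> length u = length \<sigma>}"
    by simp
qed

definition perm :: "'c cperm \<Rightarrow> nat list" where "perm x = fst (Rep_cperm x)"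
definition colors :: "'c cperm \<Rightarrow> 'c list" where "colors x = snd (Rep_cperm x)"
definition csize :: "'c cperm \<Rightarrow> nat" where "csize x = length (perm x)"

lemma perm_permutation: "perm x \<in> permutations_of_set {1..csize x}"
  and length_perm [simp]: "length (perm x) = csize x"
  and length_colors [simp]: "length (colors x) = csize x"
proof -
  have "perm x \<in> permutations_of_set {1..length (perm x)} \<and> length (colors x) = length (perm x)"
    using Rep_cperm[of x] unfolding perm_def colors_def mem_Collect_eq case_prod_beta .
  thus "perm x \<in> permutations_of_set {1..csize x}" "length (perm x) = csize x"
    "length (colors x) = csize x"
    unfolding csize_def by blast+
qed

lemma perm_Abs_cperm:
  assumes "\<sigma> \<in> permutations_of_set {1..length \<sigma>}" "length u = length \<sigma>"
  shows "perm (Abs_cperm (\<sigma>, u)) = \<sigma>" "colors (Abs_cperm (\<sigma>, u)) = u"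
proof -
  have "Rep_cperm (Abs_cperm (\<sigma>, u)) = (\<sigma>, u)"
    by (rule Abs_cperm_inverse, unfold mem_Collect_eq case_prod_conv) (intro conjI assms)
  thus "perm (Abs_cperm (\<sigma>, u)) = \<sigma>" "colors (Abs_cperm (\<sigma>, u)) = u"
    by (simp_all add: perm_def colors_def)
qed

lemma cperm_eqI: "perm x = perm y \<Longrightarrow> colors x = colors y \<Longrightarrow> x = y"
  by (simp add: perm_def colors_def Rep_cperm_inject[symmetric] prod_eq_iff)


section \<open>The Hopf algebra of colored free quasi-symmetric functions\<close>

type_synonym 'c fqsym = "'c cperm \<Rightarrow>\<^sub>0 complex"

definition G :: "nat list \<Rightarrow> 'c list \<Rightarrow> 'c fqsym" where
  "G \<sigma> u = basis (Abs_cperm (\<sigma>, u))"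
  \<comment> \<open>only meaningful if \<open>\<sigma>\<close> is a permutation of \<open>{1..n}\<close> and \<open>u\<close> has length \<open>n\<close>\<close>

definition convolution :: "nat list \<Rightarrow> nat list \<Rightarrow> nat list set" where
  "convolution \<sigma> \<sigma>' = {\<tau> \<in> permutations_of_set {1..length \<sigma> + length \<sigma>'}.
     std (take (length \<sigma>) \<tau>) = \<sigma> \<and> std (drop (length \<sigma>) \<tau>) = \<sigma>'}"

definition fq_mul :: "'c fqsym \<Rightarrow> 'c fqsym \<Rightarrow> 'c fqsym" where
  "fq_mul p q = linext (\<lambda>x. linext (\<lambda>y.
     \<Sum>\<tau>\<in>convolution (perm x) (perm y). G \<tau> (colors x @ colors y)) q) p"

definition fq_unit :: "'c fqsym" where
  "fq_unit = G [] []"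

definition restrict_values :: "'c cperm \<Rightarrow> nat \<Rightarrow> nat \<Rightarrow> 'c cperm" where
  "restrict_values x a b =
     (let w = filter (\<lambda>(i, c). a \<le> i \<and> i \<le> b) (zip (perm x) (colors x))
      in Abs_cperm (std (map fst w), map snd w))"

definition fq_comul :: "'c fqsym \<Rightarrow> ('c cperm \<times> 'c cperm \<Rightarrow>\<^sub>0 complex)" where
  "fq_comul = linext (\<lambda>x. \<Sum>i=0..csize x.
     basis (restrict_values x 1 i) \<otimes> basis (restrict_values x (i + 1) (csize x)))"

definition fq_grade :: "nat \<Rightarrow> 'c fqsym set" where
  "fq_grade n = module.span smult {basis x |x. csize x = n}"

text \<open>
  The degree 0 component is spanned by the unit, and is thereby identified with the
  complex numbers.
\<close>

definition fq_counit :: "'c fqsym \<Rightarrow> complex" where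
  "fq_counit p = Poly_Mapping.lookup p (Abs_cperm ([], []))"


section \<open>The realization by noncommutative series\<close>

text \<open>
  The space above, with its product, is the algebra of noncommutative series over the
  alphabet of colored positive integers spanned by the realizations of the basis elements.
  A series is represented by its coefficient function.
\<close>

type_synonym 'c series = "(nat \<times> 'c) list \<Rightarrow> complex"

definition series_mul :: "'c series \<Rightarrow> 'c series \<Rightarrow> 'c series" where
  "series_mul f g w = (\<Sum>i\<le>length w. f (take i w) * g (drop i w))"

definition G_series :: "nat list \<Rightarrow> 'c list \<Rightarrow> 'c series" where
  "G_series \<sigma> u w =
     (if (\<forall>a\<in>set w. 1 \<le> fst a) \<and> std (map fst w) = \<sigma> \<and> map snd w = u then 1 else 0)"

definition realize :: "'c fqsym \<Rightarrow> 'c series" where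
  "realize p w =
     (\<Sum>x\<in>Poly_Mapping.keys p. Poly_Mapping.lookup p x * G_series (perm x) (colors x) w)"

lemma std_eqI:
  assumes "length v = length w"
    and "\<And>i j. i < length v \<Longrightarrow> j < length v \<Longrightarrow>
      (v ! j < v ! i \<or> v ! j = v ! i \<and> j \<le> i) = (w ! j < w ! i \<or> w ! j = w ! i \<and> j \<le> i)"
  shows "std v = std w"
proof (rule nth_equalityI)
  fix i assume "i < length (std v)"
  hence i: "i < length v" by simp
  have "{j. j < length v \<and> (v ! j < v ! i \<or> v ! j = v ! i \<and> j \<le> i)} =
        {j. j < length w \<and> (w ! j < w ! i \<or> w ! j = w ! i \<and> j \<le> i)}"
    using assms i by auto
  thus "std v ! i = std w ! i" using i assms(1) by (simp add: std_nth)
qed (use assms(1) in simp)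

lemma std_rel_iff:
  assumes "i < length v" "j < length v"
  shows "(std v ! j < std v ! i \<or> std v ! j = std v ! i \<and> j \<le> i) =
         (v ! j < v ! i \<or> v ! j = v ! i \<and> j \<le> i)"
proof -
  have *: "(a < b \<or> a = b \<and> j \<le> i) = (c < d \<or> c = d \<and> j \<le> i)"
    if "a \<le> b \<longleftrightarrow> c < d \<or> c = d \<and> j \<le> i" "b \<le> a \<longleftrightarrow> d < c \<or> d = c \<and> i \<le> j" for a b c d :: nat
    using that by presburger
  show ?thesis
    by (rule *) (rule std_nth_le_iff[OF assms(2,1)], rule std_nth_le_iff[OF assms])
qed

lemma std_take_std: "std (take k (std v)) = std (take k v)"
proof (rule std_eqI)
  fix i j assume ij: "i < length (take k (std v))" "j < length (take k (std v))"
  show "(take k (std v) ! j < take k (std v) ! i \<or>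
           take k (std v) ! j = take k (std v) ! i \<and> j \<le> i) =
        (take k v ! j < take k v ! i \<or> take k v ! j = take k v ! i \<and> j \<le> i)"
    using std_rel_iff[of i v j] ij by simp
qed simp

lemma std_drop_std: "std (drop k (std v)) = std (drop k v)"
proof (rule std_eqI)
  fix i j assume ij: "i < length (drop k (std v))" "j < length (drop k (std v))"
  show "(drop k (std v) ! j < drop k (std v) ! i \<or>
           drop k (std v) ! j = drop k (std v) ! i \<and> j \<le> i) =
        (drop k v ! j < drop k v ! i \<or> drop k v ! j = drop k v ! i \<and> j \<le> i)"
  proof -
    have "k + i < length v" "k + j < length v" using ij unfolding length_drop length_std by linarith+
    moreover from this have "k \<le> length v" by linarith
    ultimately show ?thesis using std_rel_iff[of "k + i" v "k + j"] by simp
  qed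
qed simp

lemma std_of_permutation:
  assumes "\<sigma> \<in> permutations_of_set {1..length \<sigma>}"
  shows "std \<sigma> = \<sigma>"
proof (rule nth_equalityI)
  fix i assume "i < length (std \<sigma>)"
  hence i: "i < length \<sigma>" by simp
  note d = permutations_of_setD(2)[OF assms] and s = permutations_of_setD(1)[OF assms]
  let ?S = "{j. j < length \<sigma> \<and> (\<sigma> ! j < \<sigma> ! i \<or> \<sigma> ! j = \<sigma> ! i \<and> j \<le> i)}"
  have S: "?S = {j. j < length \<sigma> \<and> \<sigma> ! j \<le> \<sigma> ! i}"
    using d i by (auto simp: nth_eq_iff_index_eq le_less)
  have "\<sigma> ! i \<in> {1..length \<sigma>}" using i s nth_mem by blast
  have "(\<lambda>j. \<sigma> ! j) ` ?S = {x \<in> set \<sigma>. x \<le> \<sigma> ! i}"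
    unfolding S set_conv_nth by blast
  also have "\<dots> = {1..\<sigma> ! i}"
    using \<open>\<sigma> ! i \<in> {1..length \<sigma>}\<close> unfolding s by auto
  finally have "(\<lambda>j. \<sigma> ! j) ` ?S = {1..\<sigma> ! i}" .
  moreover have "inj_on (\<lambda>j. \<sigma> ! j) ?S"
    using d by (auto simp: inj_on_def nth_eq_iff_index_eq)
  ultimately have "card ?S = card {1..\<sigma> ! i}"
    using card_image by fastforce
  hence "card ?S = \<sigma> ! i" by simp
  thus "std \<sigma> ! i = \<sigma> ! i" using i by (simp add: std_nth)
qed simp

lemma lookup_smult [simp]:
  "Poly_Mapping.lookup (smult c p) x = c * Poly_Mapping.lookup p x"
  by (simp add: smult_def Poly_Mapping.map.rep_eq when_def)

lemma realize_superset:
  assumes "finite S" "Poly_Mapping.keys p \<subseteq> S"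
  shows "realize p w = (\<Sum>x\<in>S. Poly_Mapping.lookup p x * G_series (perm x) (colors x) w)"
  unfolding realize_def
  by (rule sum.mono_neutral_left) (use assms in \<open>auto simp: in_keys_iff\<close>)

lemma realize_smult: "realize (smult c p) w = c * realize p w"
proof -
  have "Poly_Mapping.keys (smult c p) \<subseteq> Poly_Mapping.keys p"
    by (auto simp: in_keys_iff)
  from realize_superset[OF finite_keys this] show ?thesis
    by (simp add: realize_def sum_distrib_left mult.assoc)
qed

lemma realize_add: "realize (p + q) w = realize p w + realize q w"
proof -
  let ?S = "Poly_Mapping.keys p \<union> Poly_Mapping.keys q"
  have "Poly_Mapping.keys (p + q) \<subseteq> ?S" by (rule Poly_Mapping.keys_add)
  thus ?thesis
    by (subst (1 2 3) realize_superset[of ?S]) (auto simp: lookup_add algebra_simps sum.distrib)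
qed

lemma realize_sum: "realize (\<Sum>i\<in>I. p i) w = (\<Sum>i\<in>I. realize (p i) w)"
proof (induction I rule: infinite_finite_induct)
  case (insert i I)
  thus ?case by (simp add: realize_add)
qed (simp_all add: realize_def)

lemma realize_basis: "realize (basis x) w = G_series (perm x) (colors x) w"
  by (simp add: realize_def basis_def)

lemma realize_G:
  assumes "\<sigma> \<in> permutations_of_set {1..length \<sigma>}" "length u = length \<sigma>"
  shows "realize (G \<sigma> u) = G_series \<sigma> u"
  by (rule ext) (simp add: G_def realize_basis perm_Abs_cperm[OF assms])

lemma realize_linext:
  "realize (linext f p) w =
     (\<Sum>x\<in>Poly_Mapping.keys p. Poly_Mapping.lookup p x * realize (f x) w)"
  by (simp add: linext_def realize_sum realize_smult)

lemma finite_convolution: "finite (convolution \<sigma> \<sigma>')"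
  unfolding convolution_def by simp

lemma G_series_mul:
  assumes "length u = length \<sigma>" "length u' = length \<sigma>'"
  shows "series_mul (G_series \<sigma> u) (G_series \<sigma>' u') w =
           (\<Sum>\<tau>\<in>convolution \<sigma> \<sigma>'. G_series \<tau> (u @ u') w)"
proof -
  let ?v = "map fst w" and ?c = "map snd w" and ?n = "length \<sigma>"
  define Q where "Q \<longleftrightarrow> (\<forall>a\<in>set w. 1 \<le> fst a) \<and> ?c = u @ u' \<and>
    std (take ?n ?v) = \<sigma> \<and> std (drop ?n ?v) = \<sigma>'"
  have set_w: "set w = set (take i w) \<union> set (drop i w)" for i
    by (metis append_take_drop_id set_append)
  have prod_eq: "G_series \<sigma> u (take i w) * G_series \<sigma>' u' (drop i w) = (if i = ?n \<and> Q then 1 else 0)"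
    if "i \<le> length w" for i
  proof (cases "i = ?n")
    case True
    have "(take ?n ?c = u \<and> drop ?n ?c = u') \<longleftrightarrow> ?c = u @ u'"
      using assms by (metis append_eq_conv_conj)
    thus ?thesis
      unfolding G_series_def Q_def set_w[of i] True
      by (auto simp: take_map drop_map)
  next
    case False
    have "std (map fst (take i w)) \<noteq> \<sigma>"
    proof
      assume "std (map fst (take i w)) = \<sigma>"
      hence "length (std (map fst (take i w))) = ?n" by simp
      thus False using that False by simp
    qed
    thus ?thesis using False by (simp add: G_series_def)
  qed
  have "series_mul (G_series \<sigma> u) (G_series \<sigma>' u') w =
          (\<Sum>i\<le>length w. if i = ?n \<and> Q then 1 else 0)"
    unfolding series_mul_def by (rule sum.cong) (simp_all add: prod_eq)
  also have "\<dots> = (\<Sum>i\<le>length w. if i = ?n then (if Q then 1 else 0) else 0)"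
    by (rule sum.cong) auto
  also have "\<dots> = (if ?n \<le> length w \<and> Q then 1 else 0)"
    by (subst sum.delta) auto
  also have "?n \<le> length w \<and> Q \<longleftrightarrow> Q"
  proof -
    have "?n \<le> length w" if Q
    proof -
      have "length ?c = length (u @ u')" using that by (simp add: Q_def)
      thus ?thesis using assms by simp
    qed
    thus ?thesis by blast
  qed
  finally have lhs: "series_mul (G_series \<sigma> u) (G_series \<sigma>' u') w = (if Q then 1 else 0)" .
  let ?P = "(\<forall>a\<in>set w. 1 \<le> fst a) \<and> ?c = u @ u'"
  have "(\<Sum>\<tau>\<in>convolution \<sigma> \<sigma>'. G_series \<tau> (u @ u') w) =
        (\<Sum>\<tau>\<in>convolution \<sigma> \<sigma>'. if \<tau> = std ?v then (if ?P then 1 else 0) else 0)"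
    by (rule sum.cong) (auto simp: G_series_def)
  also have "\<dots> = (if std ?v \<in> convolution \<sigma> \<sigma>' then (if ?P then 1 else 0) else 0)"
    by (subst sum.delta) (simp_all add: finite_convolution)
  also have "\<dots> = (if Q then 1 else 0)"
  proof -
    have "std ?v \<in> permutations_of_set {1..?n + length \<sigma>'}" if ?P
    proof -
      have "length ?c = length (u @ u')" using that by metis
      hence "length ?v = ?n + length \<sigma>'" using assms by simp
      thus ?thesis using std_permutation[of ?v] by simp
    qed
    hence "(std ?v \<in> convolution \<sigma> \<sigma>' \<and> ?P) \<longleftrightarrow> Q"
      unfolding convolution_def Q_def mem_Collect_eq std_take_std std_drop_std by blast
    thus ?thesis by metis
  qed
  finally show ?thesis using lhs by simp
qed

lemma realize_fq_mul: "realize (fq_mul p q) = series_mul (realize p) (realize q)"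
proof
  fix w :: "(nat \<times> 'a) list"
  let ?l = "Poly_Mapping.lookup" and ?k = "Poly_Mapping.keys"
  have G: "realize (G \<tau> (colors x @ colors y)) = G_series \<tau> (colors x @ colors y)"
    if "\<tau> \<in> convolution (perm x) (perm y)" for x y :: "'a cperm" and \<tau>
  proof (rule realize_G)
    have "\<tau> \<in> permutations_of_set {1..csize x + csize y}"
      using that by (simp add: convolution_def)
    moreover from this have "length \<tau> = csize x + csize y"
      using length_finite_permutations_of_set by fastforce
    ultimately show "\<tau> \<in> permutations_of_set {1..length \<tau>}"
      "length (colors x @ colors y) = length \<tau>" by simp_all
  qed
  have "realize (fq_mul p q) w = (\<Sum>x\<in>?k p. ?l p x * (\<Sum>y\<in>?k q. ?l q y *
          (\<Sum>\<tau>\<in>convolution (perm x) (perm y). G_series \<tau> (colors x @ colors y) w)))"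
    unfolding fq_mul_def realize_linext realize_sum by (simp add: G)
  also have "\<dots> = (\<Sum>x\<in>?k p. ?l p x * (\<Sum>y\<in>?k q. ?l q y *
          series_mul (G_series (perm x) (colors x)) (G_series (perm y) (colors y)) w))"
    by (simp add: G_series_mul)
  also have "\<dots> = (\<Sum>x\<in>?k p. \<Sum>y\<in>?k q. \<Sum>i\<le>length w.
          (?l p x * G_series (perm x) (colors x) (take i w)) *
          (?l q y * G_series (perm y) (colors y) (drop i w)))"
    by (simp add: series_mul_def sum_distrib_left mult_ac)
  also have "\<dots> = (\<Sum>x\<in>?k p. \<Sum>i\<le>length w. \<Sum>y\<in>?k q.
          (?l p x * G_series (perm x) (colors x) (take i w)) *
          (?l q y * G_series (perm y) (colors y) (drop i w)))"
    by (intro sum.cong refl sum.swap)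
  also have "\<dots> = (\<Sum>i\<le>length w. \<Sum>x\<in>?k p. \<Sum>y\<in>?k q.
          (?l p x * G_series (perm x) (colors x) (take i w)) *
          (?l q y * G_series (perm y) (colors y) (drop i w)))"
    by (rule sum.swap)
  also have "\<dots> = series_mul (realize p) (realize q) w"
    by (simp add: series_mul_def realize_def sum_product)
  finally show "realize (fq_mul p q) w = series_mul (realize p) (realize q) w" .
qed

lemma realize_inj: "inj realize"
proof
  fix p q :: "'c fqsym"
  have coeff: "realize p (zip (perm x) (colors x)) = Poly_Mapping.lookup p x"
    for p :: "'c fqsym" and x
  proof -
    let ?w = "zip (perm x) (colors x)"
    have w: "map fst ?w = perm x" "map snd ?w = colors x" by simp_all
    have "std (perm x) = perm x"
      using perm_permutation[of x] by (intro std_of_permutation) simp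
    moreover have "1 \<le> fst a" if "a \<in> set ?w" for a
    proof -
      have "fst a \<in> set (perm x)" using that by (metis in_set_zipE prod.collapse)
      thus ?thesis using permutations_of_setD(1)[OF perm_permutation[of x]] by simp
    qed
    ultimately have *: "G_series (perm y) (colors y) ?w = (if y = x then 1 else 0)" for y
      unfolding G_series_def w by (auto intro: cperm_eqI)
    have "realize p ?w =
            (\<Sum>y\<in>Poly_Mapping.keys p. if y = x then Poly_Mapping.lookup p x else 0)"
      unfolding realize_def * by (rule sum.cong) auto
    also have "\<dots> = Poly_Mapping.lookup p x"
      by (subst sum.delta) (auto simp: in_keys_iff)
    finally show ?thesis .
  qed
  assume "realize p = realize q"
  thus "p = q" by (intro poly_mapping_eqI) (metis coeff)
qed

end

theory Submission
  imports Defs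
begin

text \<open>
  Let \<open>p(w)\<close> denote the coefficient of \<open>p\<close> at the standardization of a colored word \<open>w\<close>.
  In the realization by series the product is the Cauchy product, so \<open>(p q)(w)\<close> is the sum of
  \<open>p(u) q(v)\<close> over all factorizations \<open>w = u v\<close>. Dually, if all letters of \<open>a\<close> are smaller than
  all letters of \<open>b\<close> and no letter is repeated, then the coefficient of \<open>\<Delta> p\<close> at the
  standardizations of \<open>(a, b)\<close> is the sum of \<open>p(w)\<close> over the shuffles \<open>w\<close> of \<open>a\<close> and \<open>b\<close>.
  Cutting a shuffle of \<open>a\<close> and \<open>b\<close> in two is the same as cutting \<open>a\<close> and \<open>b\<close> and shuffling
  the pieces, whence \<open>\<Delta>\<close> is multiplicative.
\<close>

subsection \<open>Linear maps on spaces with a basis\<close>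

lemma smult_add_right: "smult c (p + q) = smult c p + smult c q"
  by (rule poly_mapping_eqI) (simp add: lookup_add algebra_simps)

lemma smult_add_left: "smult (c + d) p = smult c p + smult d p"
  by (rule poly_mapping_eqI) (simp add: lookup_add algebra_simps)

lemma smult_smult [simp]: "smult c (smult d p) = smult (c * d) p"
  by (rule poly_mapping_eqI) simp

lemma smult_one [simp]: "smult 1 p = p"
  by (rule poly_mapping_eqI) simp

lemma smult_zero_left [simp]: "smult 0 p = 0"
  by (rule poly_mapping_eqI) simp

lemma smult_zero_right [simp]: "smult c 0 = 0"
  by (rule poly_mapping_eqI) simp

lemma smult_sum: "smult c (\<Sum>i\<in>I. p i) = (\<Sum>i\<in>I. smult c (p i))"
  by (rule poly_mapping_eqI) (simp add: lookup_sum sum_distrib_left)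

interpretation smult: vector_space smult
  by unfold_locales (simp_all add: smult_add_left smult_add_right)

lemma lookup_basis: "Poly_Mapping.lookup (basis a) b = (if a = b then 1 else 0)"
  by (simp add: basis_def lookup_single)

lemma keys_basis [simp]: "Poly_Mapping.keys (basis a) = {a}"
  by (simp add: basis_def)

lemma vector_space_complex: "vector_space ((*) :: complex \<Rightarrow> complex \<Rightarrow> complex)"
  by unfold_locales (simp_all add: algebra_simps)

lemma clinearI:
  assumes "\<And>p q. f (p + q) = f p + f q" "\<And>c p. f (smult c p) = smult c (f p)"
  shows "clinear f"
  using assms by unfold_locales simp_all

lemma clinear_formI:
  assumes "\<And>p q. f (p + q) = f p + f q" "\<And>c p. f (smult c p) = c * f p"
  shows "clinear_form f"
proof -
  interpret C: vector_space "(*) :: complex \<Rightarrow> complex \<Rightarrow> complex"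
    by (rule vector_space_complex)
  show ?thesis using assms by unfold_locales simp_all
qed

text \<open>Restates the facts about linear maps with \<open>clinear f\<close> as an explicit
  premise, so that they can be instantiated by \<open>OF\<close> with composite maps.\<close>

context
  fixes f
  assumes f: "clinear f"
begin

interpretation f: Vector_Spaces.linear smult smult f by (rule f)

lemmas clinear_add = f.add
lemmas clinear_smult = f.scale
lemmas clinear_zero = f.zero
lemmas clinear_sum = f.sum

end

lemma clinear_formD:
  assumes "clinear_form f"
  shows "f (p + q) = f p + f q" "f (smult c p) = c * f p" "f (sum h I) = (\<Sum>i\<in>I. f (h i))"
proof -
  interpret f: Vector_Spaces.linear smult "(*)" f by (rule assms)
  show "f (p + q) = f p + f q" "f (smult c p) = c * f p" "f (sum h I) = (\<Sum>i\<in>I. f (h i))"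
    by (simp_all add: f.add f.scale f.sum)
qed

lemma clinear_id: "clinear (\<lambda>x. x)" "clinear id"
  by (simp_all add: clinearI)

lemma clinear_compose: "clinear f \<Longrightarrow> clinear g \<Longrightarrow> clinear (\<lambda>x. f (g x))"
  by (intro clinearI) (simp_all add: clinear_add clinear_smult)

lemma clinear_lookup: "clinear_form (\<lambda>p. Poly_Mapping.lookup p a)"
  by (intro clinear_formI) (simp_all add: lookup_add)

text \<open>The added terms have coefficient 0. Enlarging the index set lets \<open>p\<close>,
  \<open>q\<close> and \<open>p + q\<close> be summed over one common set.\<close>

lemma linext_superset:
  assumes "finite S" "Poly_Mapping.keys p \<subseteq> S"
  shows "linext f p = (\<Sum>a\<in>S. smult (Poly_Mapping.lookup p a) (f a))"
  unfolding linext_def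
  by (rule sum.mono_neutral_left) (use assms in \<open>auto simp: in_keys_iff\<close>)

lemma clinear_linext: "clinear (linext f)"
proof (rule clinearI)
  fix p q :: "'a \<Rightarrow>\<^sub>0 complex" and c
  let ?S = "Poly_Mapping.keys p \<union> Poly_Mapping.keys q"
  have "Poly_Mapping.keys (p + q) \<subseteq> ?S" by (rule Poly_Mapping.keys_add)
  thus "linext f (p + q) = linext f p + linext f q"
    by (subst (1 2 3) linext_superset[of ?S])
       (auto simp: lookup_add smult_add_left sum.distrib)
  have "Poly_Mapping.keys (smult c p) \<subseteq> Poly_Mapping.keys p"
    by (auto simp: in_keys_iff)
  thus "linext f (smult c p) = smult c (linext f p)"
    by (subst (1 2) linext_superset[of "Poly_Mapping.keys p"]) (auto simp: smult_sum)
qed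

lemma linext_basis [simp]: "linext f (basis a) = f a"
  by (simp add: linext_def lookup_basis)

lemma basis_expansion:
  "p = (\<Sum>a\<in>Poly_Mapping.keys p. smult (Poly_Mapping.lookup p a) (basis a))"
proof (rule poly_mapping_eqI)
  fix b
  have "(\<Sum>a\<in>Poly_Mapping.keys p. Poly_Mapping.lookup p a * (if a = b then 1 else 0)) =
        (\<Sum>a\<in>Poly_Mapping.keys p. if a = b then Poly_Mapping.lookup p b else 0)"
    by (rule sum.cong) auto
  thus "Poly_Mapping.lookup p b = Poly_Mapping.lookup
          (\<Sum>a\<in>Poly_Mapping.keys p. smult (Poly_Mapping.lookup p a) (basis a)) b"
    by (simp add: lookup_sum lookup_basis in_keys_iff)
qed

lemma clinear_expansion: "clinear f \<Longrightarrow> f p = linext (\<lambda>a. f (basis a)) p"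
  by (subst basis_expansion[of p]) (simp add: clinear_sum clinear_smult linext_def)

lemma clinear_eqI:
  assumes "clinear f" "clinear g" "\<And>a. f (basis a) = g (basis a)"
  shows "f p = g p"
  unfolding clinear_expansion[OF assms(1), of p] clinear_expansion[OF assms(2), of p] assms(3) ..

lemma clinear_form_eqI:
  assumes "clinear_form f" "clinear_form g" "\<And>a. f (basis a) = g (basis a)"
  shows "f p = g p"
  by (subst (1 2) basis_expansion[of p]) (simp add: clinear_formD assms)

text \<open>For fixed \<open>p\<close> this is a finite linear combination of the maps
  \<open>\<lambda>q. F q a\<close>. It yields linearity in the second argument of bilinear maps
  defined by nested \<open>linext\<close>.\<close>

lemma clinear_linext_param:
  assumes "\<And>a. clinear (\<lambda>q. F q a)"
  shows "clinear (\<lambda>q. linext (F q) p)"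
  by (rule clinearI)
     (simp_all add: linext_def clinear_add[OF assms] clinear_smult[OF assms] smult_add_right
        sum.distrib smult_sum mult.commute)


subsection \<open>Tensor products\<close>

lemma clinear_tensor_left: "clinear (\<lambda>p. p \<otimes> q)"
  unfolding tensor_def by (rule clinear_linext)

lemma clinear_tensor_right: "clinear (\<lambda>q. p \<otimes> q)"
  unfolding tensor_def by (intro clinear_linext_param clinear_linext)

lemma tensor_basis [simp]: "basis a \<otimes> basis b = basis (a, b)"
  by (simp add: tensor_def)

text \<open>Both sides are linear in \<open>p\<close> and in \<open>q\<close>, so comparing them on
  basis vectors suffices; \<open>p\<close> is first specialized to a basis vector while
  \<open>q\<close> varies.\<close>

lemma lookup_tensor:
  "Poly_Mapping.lookup (p \<otimes> q) (a, b) = Poly_Mapping.lookup p a * Poly_Mapping.lookup q b"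
proof -
  have "Poly_Mapping.lookup (basis c \<otimes> q) (a, b) =
        Poly_Mapping.lookup (basis c) a * Poly_Mapping.lookup q b" for c
  proof (rule clinear_form_eqI[where p = q])
    show "clinear_form (\<lambda>q. Poly_Mapping.lookup (basis c \<otimes> q) (a, b))"
      by (intro clinear_formI)
         (simp_all add: clinear_add[OF clinear_tensor_right]
            clinear_smult[OF clinear_tensor_right] lookup_add)
    show "clinear_form (\<lambda>q. Poly_Mapping.lookup (basis c) a * Poly_Mapping.lookup q b)"
      by (intro clinear_formI) (simp_all add: lookup_add algebra_simps)
  qed (auto simp: lookup_basis)
  note basis_left = this
  show ?thesis
  proof (rule clinear_form_eqI[where p = p])
    show "clinear_form (\<lambda>p. Poly_Mapping.lookup (p \<otimes> q) (a, b))"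
      by (intro clinear_formI)
         (simp_all add: clinear_add[OF clinear_tensor_left]
            clinear_smult[OF clinear_tensor_left] lookup_add)
    show "clinear_form (\<lambda>p. Poly_Mapping.lookup p a * Poly_Mapping.lookup q b)"
      by (intro clinear_formI) (simp_all add: lookup_add algebra_simps)
  qed (rule basis_left)
qed

lemma clinear_tensor_map: "clinear (tensor_map f g)"
  unfolding tensor_map_def by (rule clinear_linext)

lemma tensor_map_basis: "tensor_map f g (basis (a, b)) = f (basis a) \<otimes> g (basis b)"
  by (simp add: tensor_map_def)

lemma clinear_mul_map: "clinear (mul_map mul)"
  unfolding mul_map_def by (rule clinear_linext)

lemma bilinear_eqI:
  assumes "\<And>q. clinear (\<lambda>p. f p q)" "\<And>p. clinear (f p)"
    and "\<And>q. clinear (\<lambda>p. g p q)" "\<And>p. clinear (g p)"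
    and "\<And>a b. f (basis a) (basis b) = g (basis a) (basis b)"
  shows "f p q = g p q"
proof (rule clinear_eqI[OF assms(1) assms(3)])
  show "f (basis a) q = g (basis a) q" for a
    by (rule clinear_eqI[OF assms(2) assms(4)]) (rule assms(5))
qed

lemma mul_map_tensor:
  assumes "\<And>q. clinear (\<lambda>p. mul p q)" "\<And>p. clinear (mul p)"
  shows "mul_map mul (p \<otimes> q) = mul p q"
  by (rule bilinear_eqI[where p = p and q = q,
        OF clinear_compose[OF clinear_mul_map clinear_tensor_left]
          clinear_compose[OF clinear_mul_map clinear_tensor_right] assms])
     (simp add: mul_map_def)

section \<open>Tensor products of unital algebras\<close>

context
  fixes mul1 :: "('a \<Rightarrow>\<^sub>0 complex) \<Rightarrow> ('a \<Rightarrow>\<^sub>0 complex) \<Rightarrow> ('a \<Rightarrow>\<^sub>0 complex)" and unit1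
    and mul2 :: "('b \<Rightarrow>\<^sub>0 complex) \<Rightarrow> ('b \<Rightarrow>\<^sub>0 complex) \<Rightarrow> ('b \<Rightarrow>\<^sub>0 complex)" and unit2
  assumes alg1: "unital_algebra mul1 unit1" and alg2: "unital_algebra mul2 unit2"
begin

interpretation A: unital_algebra mul1 unit1 by (rule alg1)
interpretation B: unital_algebra mul2 unit2 by (rule alg2)

lemma clinear_tensor_mul_left: "clinear (\<lambda>p. tensor_mul mul1 mul2 p q)"
  unfolding tensor_mul_def by (rule clinear_linext)

lemma clinear_tensor_mul_right: "clinear (tensor_mul mul1 mul2 p)"
  unfolding tensor_mul_def
  by (rule clinear_linext_param) (auto intro: clinear_linext split: prod.split)

lemma tensor_mul_basis:
  "tensor_mul mul1 mul2 (basis (a, b)) (basis (c, d)) =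
     mul1 (basis a) (basis c) \<otimes> mul2 (basis b) (basis d)"
  by (simp add: tensor_mul_def)

lemma tensor_mul_tensor:
  "tensor_mul mul1 mul2 (p \<otimes> q) (r \<otimes> s) = mul1 p r \<otimes> mul2 q s"
proof -
  \<comment> \<open>Items 1 to 4 are linearity of the left-hand side in \<open>p\<close>,
    \<open>q\<close>, \<open>r\<close>, \<open>s\<close>; items 5 to 8 are linearity of the
    right-hand side in \<open>p\<close>, \<open>r\<close>, \<open>q\<close>,
    \<open>s\<close>.\<close>
  note cl = clinear_compose[OF clinear_tensor_mul_left clinear_tensor_left]
    clinear_compose[OF clinear_tensor_mul_left clinear_tensor_right]
    clinear_compose[OF clinear_tensor_mul_right clinear_tensor_left]
    clinear_compose[OF clinear_tensor_mul_right clinear_tensor_right]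
    clinear_compose[OF clinear_tensor_left A.mul_linear_left]
    clinear_compose[OF clinear_tensor_left A.mul_linear_right]
    clinear_compose[OF clinear_tensor_right B.mul_linear_left]
    clinear_compose[OF clinear_tensor_right B.mul_linear_right]
  have basis_left: "tensor_mul mul1 mul2 (basis a \<otimes> basis b) (r \<otimes> s) =
      mul1 (basis a) r \<otimes> mul2 (basis b) s" for a b
    by (rule bilinear_eqI[where p = r and q = s, OF cl(3,4,6,8)])
       (simp add: tensor_mul_basis)
  show ?thesis
    by (rule bilinear_eqI[where p = p and q = q, OF cl(1,2,5,7)]) (rule basis_left)
qed

lemma unital_algebra_tensor:
  "unital_algebra (tensor_mul mul1 mul2) (unit1 \<otimes> unit2)"
proof (rule unital_algebra.intro)
  let ?m = "tensor_mul mul1 mul2"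
  note L = clinear_tensor_mul_left and R = clinear_tensor_mul_right
  show "clinear (\<lambda>x. ?m x y)" "clinear (?m x)" for x y
    by (rule L R)+
  \<comment> \<open>Every basis vector is a pure tensor, so on basis vectors the laws reduce to
    those of the two factors.\<close>
  have e: "basis x = basis (fst x) \<otimes> basis (snd x)" for x :: "'a \<times> 'b" by simp
  have bas: "?m (?m (basis u) (basis v)) (basis w) = ?m (basis u) (?m (basis v) (basis w))"
    for u v w
    unfolding e[of u] e[of v] e[of w] tensor_mul_tensor A.mul_assoc B.mul_assoc ..
  \<comment> \<open>Associativity is extended from basis vectors in the third argument first; the
    other two then follow together by bilinearity.\<close>
  have bas2: "?m (?m (basis u) (basis v)) z = ?m (basis u) (?m (basis v) z)" for u v z
    by (rule clinear_eqI[OF R clinear_compose[OF R R], OF bas])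
  show "?m (?m x y) z = ?m x (?m y z)" for x y z
    by (rule bilinear_eqI[OF clinear_compose[OF L L] clinear_compose[OF L R] L
          clinear_compose[OF R L], OF bas2])
  have "?m (unit1 \<otimes> unit2) (basis u) = basis u" "?m (basis u) (unit1 \<otimes> unit2) = basis u" for u
    by (simp_all only: e[of u] tensor_mul_tensor A.mul_unit_left B.mul_unit_left
          A.mul_unit_right B.mul_unit_right)
  note unit = this
  show "?m (unit1 \<otimes> unit2) x = x" for x
    by (rule clinear_eqI[OF R clinear_id(1), OF unit(1)])
  show "?m x (unit1 \<otimes> unit2) = x" for x
    by (rule clinear_eqI[OF L clinear_id(1), OF unit(2)])
qed

end

subsection \<open>Colored permutations as words\<close>

definition word :: "'c cperm \<Rightarrow> (nat \<times> 'c) list" where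
  "word x = zip (perm x) (colors x)"

text \<open>Meaningful for every colored word, because \<open>std\<close> always returns a
  permutation. Factors, shuffles and shifted words can thus be standardized without side
  conditions.\<close>

definition of_word :: "(nat \<times> 'c) list \<Rightarrow> 'c cperm" where
  "of_word w = Abs_cperm (std (map fst w), map snd w)"

lemma map_fst_word [simp]: "map fst (word x) = perm x"
  and map_snd_word [simp]: "map snd (word x) = colors x"
  and length_word [simp]: "length (word x) = csize x"
  by (simp_all add: word_def)

lemma fst_set_word: "fst ` set (word x) = {1..csize x}"
  using permutations_of_setD(1)[OF perm_permutation[of x]] by (simp flip: set_map)

lemma fst_word_bounds: "(i, c) \<in> set (word x) \<Longrightarrow> 1 \<le> i \<and> i \<le> csize x"
  using fst_set_word[of x] by (metis atLeastAtMost_iff fst_conv imageI)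

lemma distinct_perm: "distinct (perm x)"
  by (rule permutations_of_setD(2)[OF perm_permutation])

lemma perm_of_word [simp]: "perm (of_word w) = std (map fst w)"
  and colors_of_word [simp]: "colors (of_word w) = map snd w"
  unfolding of_word_def by (rule perm_Abs_cperm; use std_permutation[of "map fst w"] in simp)+

lemma csize_of_word [simp]: "csize (of_word w) = length w"
  by (simp add: csize_def)

lemma of_word_eqI:
  "std (map fst v) = std (map fst w) \<Longrightarrow> map snd v = map snd w \<Longrightarrow> of_word v = of_word w"
  by (simp add: of_word_def)

lemma word_of_word: "word (of_word w) = zip (std (map fst w)) (map snd w)"
  by (simp add: word_def)

lemma of_word_word [simp]: "of_word (word x) = x"
  by (rule cperm_eqI) (use perm_permutation[of x] in \<open>simp_all add: std_of_permutation\<close>)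

text \<open>Standardization sees only the comparisons between letters, and these are preserved by
  \<open>f\<close>.\<close>

lemma std_map:
  assumes "strict_mono_on (set v) f"
  shows "std (map f v) = std v"
proof (rule std_eqI)
  fix i j assume "i < length (map f v)" "j < length (map f v)"
  hence ij: "i < length v" "j < length v" by simp_all
  hence "f (v ! j) < f (v ! i) \<longleftrightarrow> v ! j < v ! i" "f (v ! j) = f (v ! i) \<longleftrightarrow> v ! j = v ! i"
    using ij strict_mono_on_less[OF assms nth_mem nth_mem]
      inj_on_eq_iff[OF strict_mono_on_imp_inj_on[OF assms] nth_mem nth_mem]
    by blast+
  thus "(map f v ! j < map f v ! i \<or> map f v ! j = map f v ! i \<and> j \<le> i) =
        (v ! j < v ! i \<or> v ! j = v ! i \<and> j \<le> i)"
    by (simp only: nth_map ij)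
qed simp

lemma of_word_map:
  assumes "strict_mono_on (fst ` set w) f"
  shows "of_word (map (map_prod f id) w) = of_word w"
proof (rule of_word_eqI)
  have "map fst (map (map_prod f id) w) = map f (map fst w)" by (simp add: comp_def)
  thus "std (map fst (map (map_prod f id) w)) = std (map fst w)"
    using std_map[of "map fst w" f] assms by simp
qed (simp add: comp_def)

lemma word_of_word_standard:
  assumes "distinct (map fst w)" "fst ` set w = {1..length w}"
  shows "word (of_word w) = w"
proof -
  have "std (map fst w) = map fst w"
    using assms by (intro std_of_permutation permutations_of_setI) simp_all
  thus ?thesis by (simp add: word_of_word zip_map_fst_snd)
qed

section \<open>Coefficients of products as sums over cuts of a word\<close>

lemma of_word_take_word: "of_word (take k (word (of_word w))) = of_word (take k w)"
  by (rule of_word_eqI)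
     (simp_all add: take_map [symmetric] std_take_std)

lemma of_word_drop_word: "of_word (drop k (word (of_word w))) = of_word (drop k w)"
  by (rule of_word_eqI)
     (simp_all add: drop_map [symmetric] std_drop_std)

text \<open>Among the series \<open>G_series (perm x) (colors x)\<close>, exactly the one indexed by
  the standardization of \<open>w\<close> contains \<open>w\<close>. Coefficients of series
  therefore become coefficients in the basis.\<close>

lemma realize_eq_lookup:
  assumes "\<forall>a\<in>set w. 1 \<le> fst a"
  shows "realize p w = Poly_Mapping.lookup p (of_word w)"
proof -
  have "G_series (perm x) (colors x) w = (if x = of_word w then 1 else 0)" for x
  proof -
    have "std (map fst w) = perm x \<and> map snd w = colors x \<longleftrightarrow> x = of_word w"
      by (metis cperm_eqI perm_of_word colors_of_word)
    with assms show ?thesis unfolding G_series_def by presburger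
  qed
  hence "realize p w = (\<Sum>x\<in>Poly_Mapping.keys p.
      if x = of_word w then Poly_Mapping.lookup p (of_word w) else 0)"
    unfolding realize_def by (intro sum.cong) auto
  thus ?thesis by (simp add: in_keys_iff)
qed

text \<open>The Cauchy product formula \<open>realize_fq_mul\<close>, read off at a single
  word.\<close>

lemma lookup_fq_mul:
  "Poly_Mapping.lookup (fq_mul p q) (of_word w) =
     (\<Sum>i\<le>length w. Poly_Mapping.lookup p (of_word (take i w)) *
                    Poly_Mapping.lookup q (of_word (drop i w)))"
proof -
  \<comment> \<open>The letter 0 may occur in \<open>w\<close>, but the realization only sees
    positive letters. The formula is applied to the standardized word and carried back, since
    standardizing before a cut does not change the standardized parts.\<close>
  let ?w = "word (of_word w)"
  have pos: "\<forall>a\<in>set ?w. 1 \<le> fst a" using fst_word_bounds by force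
  hence "\<forall>a\<in>set (take i ?w). 1 \<le> fst a" "\<forall>a\<in>set (drop i ?w). 1 \<le> fst a" for i
    by (auto dest: in_set_takeD in_set_dropD)
  hence "realize (fq_mul p q) ?w =
      (\<Sum>i\<le>length w. Poly_Mapping.lookup p (of_word (take i ?w)) *
                    Poly_Mapping.lookup q (of_word (drop i ?w)))"
    by (simp add: realize_fq_mul series_mul_def realize_eq_lookup)
  thus ?thesis
    using realize_eq_lookup[OF pos] by (simp add: of_word_take_word of_word_drop_word)
qed

lemma lookup_fq_mul_word:
  "Poly_Mapping.lookup (fq_mul p q) x =
     (\<Sum>i\<le>csize x. Poly_Mapping.lookup p (of_word (take i (word x))) *
                    Poly_Mapping.lookup q (of_word (drop i (word x))))"
  using lookup_fq_mul[of p q "word x"] by simp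

section \<open>Restriction to half-open intervals of values, so that consecutive segments share an
  endpoint\<close>

abbreviation seg :: "'c cperm \<Rightarrow> nat \<Rightarrow> nat \<Rightarrow> 'c cperm" where
  "seg x k m \<equiv> restrict_values x (Suc k) m"

lemma restrict_values_of_word:
  "restrict_values x a b = of_word (filter (\<lambda>(i, c). a \<le> i \<and> i \<le> b) (word x))"
  by (simp add: restrict_values_def of_word_def word_def Let_def)

text \<open>The letters kept are exactly \<open>k + 1\<close> to \<open>m\<close>, each once.
  Subtracting \<open>k\<close> preserves their order and makes the word standard, so standardization
  here is just a shift.\<close>

lemma word_seg:
  assumes "k \<le> m" "m \<le> csize x"
  shows "word (seg x k m) =
    map (map_prod (\<lambda>i. i - k) id) (filter (\<lambda>(i, c). Suc k \<le> i \<and> i \<le> m) (word x))"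
    (is "_ = map ?f ?w")
    and "csize (seg x k m) = m - k"
proof -
  have fst_w: "fst ` set ?w = {Suc k..m}"
  proof -
    have "fst ` set ?w = fst ` set (word x) \<inter> {Suc k..m}" by force
    thus ?thesis using assms by (auto simp: fst_set_word)
  qed
  have dist: "distinct (map fst ?w)"
    by (rule distinct_map_filter) (simp add: distinct_perm)
  have len: "length ?w = m - k"
    using distinct_card[OF dist] fst_w by simp
  thus "csize (seg x k m) = m - k" by (simp add: restrict_values_of_word)
  have "strict_mono_on (fst ` set ?w) (\<lambda>i. i - k)"
    unfolding fst_w by (auto simp: strict_mono_on_def)
  hence "seg x k m = of_word (map ?f ?w)"
    using of_word_map by (metis restrict_values_of_word)
  also have "word \<dots> = map ?f ?w"
  proof (rule word_of_word_standard)
    have e: "map fst (map ?f ?w) = map (\<lambda>i. i - k) (map fst ?w)" by (simp add: comp_def)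
    have "inj_on (\<lambda>i. i - k) {Suc k..m}" by (auto simp: inj_on_def)
    thus "distinct (map fst (map ?f ?w))"
      unfolding e using dist fst_w by (simp only: distinct_map set_map simp_thms)
    have "fst ` set (map ?f ?w) = (\<lambda>i. i - k) ` fst ` set ?w" by (simp add: image_image)
    also have "\<dots> = (\<lambda>i. i - k) ` {Suc k..m}" by (simp only: fst_w)
    also have "\<dots> = {1..m - k}"
    proof -
      have "j \<in> (\<lambda>i. i - k) ` {Suc k..m}" if "j \<in> {1..m - k}" for j
        using that by (intro image_eqI[of _ _ "j + k"]) auto
      thus ?thesis by auto
    qed
    finally show "fst ` set (map ?f ?w) = {1..length (map ?f ?w)}" by (simp add: len)
  qed
  finally show "word (seg x k m) = map ?f ?w" .
qed

text \<open>Passing to the segment lowers the values by \<open>k\<close>, so its interval from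
  \<open>i\<close> to \<open>j\<close> comes from the interval from \<open>k + i\<close> to
  \<open>k + j\<close> in \<open>x\<close>. Iterated coproducts thereby become repeated cuts of one
  interval.\<close>

lemma seg_seg:
  assumes "k \<le> m" "m \<le> csize x" "k + j \<le> m"
  shows "seg (seg x k m) i j = seg x (k + i) (k + j)"
proof -
  let ?w = "filter (\<lambda>(l, c). Suc (k + i) \<le> l \<and> l \<le> k + j) (word x)"
  have "filter (\<lambda>(l, c). Suc i \<le> l \<and> l \<le> j) (word (seg x k m)) = map (map_prod (\<lambda>i. i - k) id) ?w"
    unfolding word_seg(1)[OF assms(1,2)] filter_map comp_def filter_filter
    by (rule arg_cong[of _ _ "map _"], rule filter_cong) (use assms in auto)
  moreover have "strict_mono_on (fst ` set ?w) (\<lambda>i. i - k)"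
    by (auto simp: strict_mono_on_def)
  ultimately show ?thesis
    by (simp add: restrict_values_of_word of_word_map)
qed

lemma seg_full: "seg x 0 (csize x) = x"
proof -
  have "filter (\<lambda>(i, c). Suc 0 \<le> i \<and> i \<le> csize x) (word x) = word x"
    using fst_word_bounds by (intro filter_True) fastforce
  thus ?thesis by (simp add: restrict_values_of_word)
qed

lemma fq_comul_basis:
  "fq_comul (basis x) = (\<Sum>i\<le>csize x. basis (seg x 0 i, seg x i (csize x)))"
  by (simp add: fq_comul_def atMost_atLeast0)

lemma clinear_fq_comul: "clinear fq_comul"
  unfolding fq_comul_def by (rule clinear_linext)

subsection \<open>The algebra structure\<close>

lemma fq_unit_eq: "fq_unit = basis (of_word [])"
  by (simp add: fq_unit_def G_def of_word_def std_def)

lemma fq_counit_eq: "fq_counit p = Poly_Mapping.lookup p (of_word [])"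
  by (simp add: fq_counit_def of_word_def std_def)

lemma of_word_eq_Nil_iff: "of_word [] = of_word w \<longleftrightarrow> w = []"
  by (metis csize_of_word length_0_conv)

lemma csize_eq_0_iff: "csize x = 0 \<longleftrightarrow> x = of_word []"
  by (metis csize_of_word length_0_conv length_word of_word_word)

lemma lookup_fq_unit: "Poly_Mapping.lookup fq_unit (of_word w) = (if w = [] then 1 else 0)"
  by (simp add: fq_unit_eq lookup_basis of_word_eq_Nil_iff)

lemma clinear_fq_mul_left: "clinear (\<lambda>p. fq_mul p q)"
  unfolding fq_mul_def by (rule clinear_linext)

lemma clinear_fq_mul_right: "clinear (fq_mul p)"
  unfolding fq_mul_def by (rule clinear_linext_param) (rule clinear_linext)

text \<open>Two nested cut positions \<open>j \<le> i\<close> are recorded by \<open>j\<close> and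
  the difference \<open>k = i - j\<close>. The same reindexing serves associativity, coassociativity
  and the comparison of the two antipodes.\<close>

lemma sum_triangle_assoc:
  fixes f :: "nat \<Rightarrow> nat \<Rightarrow> 'a::comm_monoid_add"
  shows "(\<Sum>i\<le>n. \<Sum>j\<le>i. f j i) = (\<Sum>j\<le>n. \<Sum>k\<le>n - j. f j (j + k))"
  unfolding sum.Sigma[OF finite_atMost ballI[OF finite_atMost]]
  by (rule sum.reindex_bij_witness[where
        i = "\<lambda>(j, k). (j + k, j)" and j = "\<lambda>(i, j). (j, i - j)"]) auto

text \<open>Both sides sum over all ways to cut the word of \<open>x\<close> into three consecutive
  factors.\<close>

lemma fq_mul_assoc: "fq_mul (fq_mul p q) r = fq_mul p (fq_mul q r)"
proof (rule poly_mapping_eqI)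
  fix x :: "'a cperm"
  let ?l = Poly_Mapping.lookup and ?w = "word x"
  have "?l (fq_mul (fq_mul p q) r) x = (\<Sum>i\<le>csize x. \<Sum>j\<le>i.
      ?l p (of_word (take j ?w)) * ?l q (of_word (take (i - j) (drop j ?w))) * ?l r (of_word (drop i ?w)))"
    unfolding lookup_fq_mul_word[of _ _ x]
    by (rule sum.cong[OF refl]) (auto simp: lookup_fq_mul sum_distrib_right min_def drop_take)
  also have "\<dots> = (\<Sum>j\<le>csize x. \<Sum>k\<le>csize x - j.
      ?l p (of_word (take j ?w)) * ?l q (of_word (take k (drop j ?w))) * ?l r (of_word (drop (j + k) ?w)))"
    by (subst sum_triangle_assoc) simp
  also have "\<dots> = ?l (fq_mul p (fq_mul q r)) x"
    unfolding lookup_fq_mul_word[of _ _ x]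
    by (rule sum.cong[OF refl])
       (auto simp: lookup_fq_mul sum_distrib_left mult.assoc add.commute intro!: sum.cong)
  finally show "?l (fq_mul (fq_mul p q) r) x = ?l (fq_mul p (fq_mul q r)) x" .
qed

lemma fq_mul_unit_left: "fq_mul fq_unit p = p"
proof (rule poly_mapping_eqI)
  fix x
  have "Poly_Mapping.lookup (fq_mul fq_unit p) x =
      (\<Sum>i\<le>csize x. if i = 0 then Poly_Mapping.lookup p x else 0)"
    unfolding lookup_fq_mul_word
    by (rule sum.cong[OF refl]) (auto simp: lookup_fq_unit simp flip: length_0_conv)
  thus "Poly_Mapping.lookup (fq_mul fq_unit p) x = Poly_Mapping.lookup p x" by simp
qed

lemma fq_mul_unit_right: "fq_mul p fq_unit = p"
proof (rule poly_mapping_eqI)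
  fix x
  have "Poly_Mapping.lookup (fq_mul p fq_unit) x =
      (\<Sum>i\<le>csize x. if i = csize x then Poly_Mapping.lookup p x else 0)"
    unfolding lookup_fq_mul_word
    by (rule sum.cong[OF refl]) (auto simp: lookup_fq_unit simp flip: length_0_conv)
  thus "Poly_Mapping.lookup (fq_mul p fq_unit) x = Poly_Mapping.lookup p x" by simp
qed

lemma unital_algebra_fq: "unital_algebra fq_mul fq_unit"
  by (rule unital_algebra.intro)
     (rule clinear_fq_mul_left clinear_fq_mul_right fq_mul_assoc fq_mul_unit_left
        fq_mul_unit_right)+


subsection \<open>The coproduct in coordinates\<close>

text \<open>\<open>P\<close> reveals which of the two words a letter comes from, so a shuffle is
  undone by filtering.\<close>

lemma shuffles_iff_filter:
  assumes "\<And>a. a \<in> set xs \<Longrightarrow> P a" "\<And>a. a \<in> set ys \<Longrightarrow> \<not> P a"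
  shows "w \<in> shuffles xs ys \<longleftrightarrow> filter P w = xs \<and> filter (\<lambda>a. \<not> P a) w = ys"
proof -
  have "w \<in> shuffles xs ys \<longleftrightarrow> w \<in> partition P -` {(xs, ys)}"
    using inv_image_partition[of xs P ys] assms by blast
  thus ?thesis by (simp add: comp_def)
qed

lemma map_shuffles: "map f ` shuffles xs ys = shuffles (map f xs) (map f ys)"
proof (induction xs ys rule: shuffles.induct)
  case (3 x xs y ys)
  have "map f ` shuffles (x # xs) (y # ys) =
      (#) (f x) ` (map f ` shuffles xs (y # ys)) \<union> (#) (f y) ` (map f ` shuffles (x # xs) ys)"
    by (simp add: image_Un image_image)
  also have "\<dots> = shuffles (map f (x # xs)) (map f (y # ys))"
    unfolding 3 by simp
  finally show ?case .
qed simp_all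

section \<open>Ranks and the standardization of words with distinct letters\<close>

lemma strict_mono_on_rank:
  assumes "finite A"
  shows "strict_mono_on A (\<lambda>i :: nat. card {j \<in> A. j \<le> i})"
proof (rule strict_mono_onI)
  fix i j assume "i \<in> A" "j \<in> A" "i < j"
  hence "{l \<in> A. l \<le> i} \<subseteq> {l \<in> A. l \<le> j}" "j \<in> {l \<in> A. l \<le> j}" "j \<notin> {l \<in> A. l \<le> i}"
    by auto
  hence "{l \<in> A. l \<le> i} \<subset> {l \<in> A. l \<le> j}" by blast
  thus "card {l \<in> A. l \<le> i} < card {l \<in> A. l \<le> j}"
    using assms by (intro psubset_card_mono) auto
qed

text \<open>Replacing letters by their ranks is strictly increasing, hence does not affect the
  standardization. With distinct letters the ranks fill up \<open>{1..length w}\<close>, so the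
  ranked word is already standard.\<close>

lemma word_of_word_rank:
  assumes "distinct (map fst w)"
  shows "word (of_word w) = map (map_prod (\<lambda>i. card {j \<in> fst ` set w. j \<le> i}) id) w"
proof -
  let ?r = "\<lambda>i. card {j \<in> fst ` set w. j \<le> i}"
  let ?v = "map (map_prod ?r id) w"
  have mono: "strict_mono_on (fst ` set w) ?r"
    by (rule strict_mono_on_rank) simp
  have fst_v: "map fst ?v = map ?r (map fst w)" by (simp add: comp_def)
  have "word (of_word ?v) = ?v"
  proof (rule word_of_word_standard)
    show d: "distinct (map fst ?v)"
      unfolding fst_v using assms strict_mono_on_imp_inj_on[OF mono]
      by (simp only: distinct_map set_map simp_thms)
    have "fst ` set ?v \<subseteq> {1..length ?v}"
    proof
      fix a assume "a \<in> fst ` set ?v"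
      then obtain i where i: "i \<in> fst ` set w" and a: "a = ?r i" by force
      have "{j \<in> fst ` set w. j \<le> i} \<noteq> {}" using i by blast
      hence "?r i \<noteq> 0" by (subst card_0_eq) auto
      moreover have "?r i \<le> card (fst ` set w)" by (rule card_mono) auto
      moreover have "card (fst ` set w) \<le> length w"
        using card_length[of "map fst w"] by simp
      ultimately show "a \<in> {1..length ?v}" unfolding a atLeastAtMost_iff length_map by linarith
    qed
    moreover have "card (fst ` set ?v) = length ?v"
      using distinct_card[OF d] by (simp only: set_map length_map)
    ultimately show "fst ` set ?v = {1..length ?v}" by (intro card_subset_eq) auto
  qed
  thus ?thesis by (simp only: of_word_map[OF mono])
qed

abbreviation shifted_word :: "nat \<Rightarrow> 'c cperm \<Rightarrow> (nat \<times> 'c) list" where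
  "shifted_word k x \<equiv> map (map_prod ((+) k) id) (word x)"

lemma fst_set_shifted_word: "fst ` set (shifted_word k x) = {k + 1..k + csize x}"
proof -
  have "fst ` set (shifted_word k x) = (+) k ` fst ` set (word x)"
    by (simp add: image_image)
  thus ?thesis by (simp only: fst_set_word image_add_atLeastAtMost add.commute)
qed

lemma distinct_map_fst_word: "distinct (map fst (word x))"
  by (simp add: distinct_perm)

lemma distinct_map_fst_shifted_word: "distinct (map fst (shifted_word k x))"
proof -
  have "map fst (shifted_word k x) = map ((+) k) (perm x)"
    by (simp add: comp_def flip: map_fst_word)
  thus ?thesis by (simp add: distinct_map distinct_perm)
qed

lemma of_word_shifted_word [simp]: "of_word (shifted_word k x) = x"
  by (simp add: of_word_map strict_mono_on_def)

text \<open>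
  Since the letters of \<open>word y\<close> and \<open>shifted_word (csize y) z\<close> fill up an initial interval of
  the integers, a shuffle of the two is standard and determines the position of the cut.
\<close>

lemma lookup_fq_comul_standard:
  "Poly_Mapping.lookup (fq_comul p) (y, z) =
     (\<Sum>w\<in>shuffles (word y) (shifted_word (csize y) z). Poly_Mapping.lookup p (of_word w))"
proof -
  let ?l = Poly_Mapping.lookup and ?k = "csize y"
  let ?S = "shuffles (word y) (shifted_word (csize y) z)"
  have shuffle_iff: "w \<in> ?S \<longleftrightarrow> filter (\<lambda>(i, c). i \<le> ?k) w = word y \<and>
      filter (\<lambda>(i, c). \<not> i \<le> ?k) w = shifted_word ?k z" for w
  proof -
    have "w \<in> ?S \<longleftrightarrow> filter (\<lambda>a. fst a \<le> ?k) w = word y \<and>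
        filter (\<lambda>a. \<not> fst a \<le> ?k) w = shifted_word ?k z"
    proof (rule shuffles_iff_filter)
      show "fst a \<le> ?k" if "a \<in> set (word y)" for a
        using that fst_set_word[of y] by (metis atLeastAtMost_iff imageI)
      show "\<not> fst a \<le> ?k" if "a \<in> set (shifted_word ?k z)" for a
        using that fst_set_shifted_word[of ?k z]
        by (metis atLeastAtMost_iff imageI not_less_eq_eq Suc_eq_plus1)
    qed
    thus ?thesis by (simp add: case_prod_beta')
  qed
  have standard: "word (of_word w) = w" if "w \<in> ?S" for w
  proof (rule word_of_word_standard)
    have sw: "set w = set (word y) \<union> set (shifted_word ?k z)"
      and lw: "length w = ?k + csize z"
      using set_shuffles[OF that] length_shuffles[OF that] by simp_all
    have "fst ` set w = {1..?k} \<union> {?k + 1..?k + csize z}"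
      unfolding sw image_Un fst_set_word fst_set_shifted_word ..
    thus fw: "fst ` set w = {1..length w}" unfolding lw by auto
    show "distinct (map fst w)"
      by (rule card_distinct) (simp add: fw)
  qed
  have "?l (fq_comul (basis x)) (y, z) = (\<Sum>w\<in>?S. ?l (basis x) (of_word w))" for x
  proof -
    \<comment> \<open>Cutting the values of \<open>x\<close> at \<open>csize y\<close> gives
      \<open>(y, z)\<close> exactly when the word of \<open>x\<close> is one of the shuffles;
      filtering by the threshold \<open>csize y\<close> translates between the two.\<close>
    have word_in: "word x \<in> ?S \<longleftrightarrow> ?k \<le> csize x \<and> seg x 0 ?k = y \<and> seg x ?k (csize x) = z"
    proof (intro iffI conjI)
      assume w: "word x \<in> ?S"
      have fy: "filter (\<lambda>(i, c). i \<le> ?k) (word x) = word y"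
        and fz: "filter (\<lambda>(i, c). \<not> i \<le> ?k) (word x) = shifted_word ?k z"
        using w shuffle_iff by blast+
      show "?k \<le> csize x" using length_shuffles[OF w] by simp
      have "filter (\<lambda>(i, c). Suc 0 \<le> i \<and> i \<le> ?k) (word x) = word y"
        unfolding fy[symmetric] by (rule filter_cong) (use fst_word_bounds in fastforce)+
      thus "seg x 0 ?k = y" by (simp add: restrict_values_of_word)
      have "filter (\<lambda>(i, c). Suc ?k \<le> i \<and> i \<le> csize x) (word x) = shifted_word ?k z"
        unfolding fz[symmetric] by (rule filter_cong) (use fst_word_bounds in fastforce)+
      thus "seg x ?k (csize x) = z" by (simp add: restrict_values_of_word)
    next
      assume h: "?k \<le> csize x \<and> seg x 0 ?k = y \<and> seg x ?k (csize x) = z"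
      have "word y = map (map_prod (\<lambda>i. i - 0) id)
          (filter (\<lambda>(i, c). Suc 0 \<le> i \<and> i \<le> ?k) (word x))"
        using word_seg(1)[of 0 ?k x] h by simp
      also have "\<dots> = filter (\<lambda>(i, c). Suc 0 \<le> i \<and> i \<le> ?k) (word x)"
        by (simp add: map_prod_def case_prod_beta')
      also have "\<dots> = filter (\<lambda>(i, c). i \<le> ?k) (word x)"
        by (rule filter_cong) (use fst_word_bounds in fastforce)+
      finally have fy: "filter (\<lambda>(i, c). i \<le> ?k) (word x) = word y" ..
      have "shifted_word ?k z = map (map_prod ((+) ?k) id) (map (map_prod (\<lambda>i. i - ?k) id)
          (filter (\<lambda>(i, c). Suc ?k \<le> i \<and> i \<le> csize x) (word x)))"
        using word_seg(1)[of ?k "csize x" x] h by simp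
      also have "\<dots> = filter (\<lambda>(i, c). Suc ?k \<le> i \<and> i \<le> csize x) (word x)"
        unfolding map_map by (rule map_idI) auto
      also have "\<dots> = filter (\<lambda>(i, c). \<not> i \<le> ?k) (word x)"
        by (rule filter_cong) (use fst_word_bounds in fastforce)+
      finally have "filter (\<lambda>(i, c). \<not> i \<le> ?k) (word x) = shifted_word ?k z" ..
      with fy show "word x \<in> ?S" using shuffle_iff by blast
    qed
    have "?l (fq_comul (basis x)) (y, z) =
        (\<Sum>i\<le>csize x. if seg x 0 i = y \<and> seg x i (csize x) = z then 1 else 0)"
      by (simp add: fq_comul_basis lookup_sum lookup_basis)
    \<comment> \<open>The left segment of the cut at \<open>i\<close> has size \<open>i\<close>, so
      only \<open>i = csize y\<close> can produce \<open>y\<close>.\<close>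
    also have "\<dots> = (\<Sum>i\<le>csize x. if i = ?k then
           if seg x 0 ?k = y \<and> seg x ?k (csize x) = z then 1 else 0 else 0)"
    proof (rule sum.cong[OF refl])
      fix i assume "i \<in> {..csize x}"
      hence "csize (seg x 0 i) = i" using word_seg(2)[of 0 i x] by simp
      thus "(if seg x 0 i = y \<and> seg x i (csize x) = z then 1 else 0 :: complex) =
          (if i = ?k then if seg x 0 ?k = y \<and> seg x ?k (csize x) = z then 1 else 0 else 0)"
        by auto
    qed
    also have "\<dots> = (if word x \<in> ?S then 1 else 0)"
      unfolding word_in by (simp add: sum.delta)
    also have "\<dots> = (\<Sum>w\<in>?S. if w = word x then 1 else 0)"
      by (simp add: sum.delta)
    also have "\<dots> = (\<Sum>w\<in>?S. ?l (basis x) (of_word w))"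
    proof (rule sum.cong[OF refl])
      fix w assume "w \<in> ?S"
      hence "x = of_word w \<longleftrightarrow> w = word x" using standard by (metis of_word_word)
      thus "(if w = word x then 1 else 0) = ?l (basis x) (of_word w)"
        by (simp add: lookup_basis)
    qed
    finally show ?thesis .
  qed
  note on_basis = this
  have "clinear_form (\<lambda>p. ?l (fq_comul p) (y, z))"
    by (rule clinear_formI)
       (simp_all add: clinear_add[OF clinear_fq_comul] clinear_smult[OF clinear_fq_comul] lookup_add)
  moreover have "clinear_form (\<lambda>p. \<Sum>w\<in>?S. ?l p (of_word w))"
    by (rule clinear_formI) (simp_all add: lookup_add sum.distrib sum_distrib_left)
  ultimately show ?thesis by (rule clinear_form_eqI) (rule on_basis)
qed

text \<open>Reduction to the standard case: ranking the letters of \<open>a\<close> and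
  \<open>b\<close> jointly turns them into the standard word of \<open>of_word a\<close> and the
  shifted standard word of \<open>of_word b\<close>, while shuffles keep their
  standardizations.\<close>

lemma lookup_fq_comul:
  assumes "distinct (map fst a)" "distinct (map fst b)"
    and less: "\<And>i j. i \<in> fst ` set a \<Longrightarrow> j \<in> fst ` set b \<Longrightarrow> i < j"
  shows "Poly_Mapping.lookup (fq_comul p) (of_word a, of_word b) =
    (\<Sum>w\<in>shuffles a b. Poly_Mapping.lookup p (of_word w))"
proof -
  let ?L = "fst ` set a" and ?M = "fst ` set b"
  let ?r = "\<lambda>i. card {j \<in> ?L \<union> ?M. j \<le> i}"
  let ?f = "map_prod ?r id"
  have mono: "strict_mono_on (?L \<union> ?M) ?r"
    by (rule strict_mono_on_rank) simp
  have a: "word (of_word a) = map ?f a"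
    unfolding word_of_word_rank[OF assms(1)]
  proof (rule map_cong[OF refl])
    fix x assume "x \<in> set a"
    hence "\<not> j \<le> fst x" if "j \<in> ?M" for j using less[of "fst x" j] that by simp
    hence "{j \<in> ?L \<union> ?M. j \<le> fst x} = {j \<in> ?L. j \<le> fst x}" by blast
    thus "map_prod (\<lambda>i. card {j \<in> ?L. j \<le> i}) id x = ?f x"
      by (cases x) simp
  qed
  have cardL: "card ?L = length a" using distinct_card[OF assms(1)] by simp
  \<comment> \<open>Every letter of \<open>a\<close> lies below a letter of \<open>b\<close>. The
    joint rank is therefore the rank within \<open>b\<close> increased by \<open>length a\<close>,
    which is the required shift.\<close>
  have b: "shifted_word (length a) (of_word b) = map ?f b"
    unfolding word_of_word_rank[OF assms(2)] map_map
  proof (rule map_cong[OF refl])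
    fix x assume x: "x \<in> set b"
    hence "j \<le> fst x" if "j \<in> ?L" for j using less[of j "fst x"] that by simp
    hence "{j \<in> ?L \<union> ?M. j \<le> fst x} = ?L \<union> {j \<in> ?M. j \<le> fst x}" by blast
    moreover have "?L \<inter> {j \<in> ?M. j \<le> fst x} = {}" using less by blast
    ultimately have "?r (fst x) = card ?L + card {j \<in> ?M. j \<le> fst x}"
      by (simp add: card_Un_disjoint)
    thus "(map_prod ((+) (length a)) id \<circ> map_prod (\<lambda>i. card {j \<in> ?M. j \<le> i}) id) x = ?f x"
      by (cases x) (simp add: cardL)
  qed
  have inj_f: "inj_on ?f (set a \<union> set b)"
  proof (rule inj_onI)
    fix u v assume uv: "u \<in> set a \<union> set b" "v \<in> set a \<union> set b" and eq: "?f u = ?f v"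
    have "?r (fst u) = ?r (fst v)" using arg_cong[OF eq, of fst] by (simp only: fst_map_prod)
    moreover have "fst u \<in> ?L \<union> ?M" "fst v \<in> ?L \<union> ?M" using uv by auto
    ultimately have "fst u = fst v" using inj_onD[OF strict_mono_on_imp_inj_on[OF mono]] by blast
    moreover have "snd u = snd v" using arg_cong[OF eq, of snd] by (simp only: snd_map_prod id_apply)
    ultimately show "u = v" by (rule prod_eqI)
  qed
  \<comment> \<open>Distinct shuffles must stay distinct after ranking for the sum to be reindexed
    without multiplicities.\<close>
  have "inj_on (map ?f) (shuffles a b)"
  proof (rule inj_onI)
    fix v w assume "v \<in> shuffles a b" "w \<in> shuffles a b" "map ?f v = map ?f w"
    thus "v = w" using inj_on_map_eq_map[of ?f v w] inj_f by (simp add: set_shuffles)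
  qed
  hence "(\<Sum>w\<in>map ?f ` shuffles a b. Poly_Mapping.lookup p (of_word w)) =
      (\<Sum>w\<in>shuffles a b. Poly_Mapping.lookup p (of_word (map ?f w)))"
    by (simp add: sum.reindex)
  also have "\<dots> = (\<Sum>w\<in>shuffles a b. Poly_Mapping.lookup p (of_word w))"
  proof (rule sum.cong[OF refl])
    fix w assume "w \<in> shuffles a b"
    hence "fst ` set w = ?L \<union> ?M" by (simp add: set_shuffles image_Un)
    thus "Poly_Mapping.lookup p (of_word (map ?f w)) = Poly_Mapping.lookup p (of_word w)"
      using of_word_map[of w ?r] mono by simp
  qed
  finally show ?thesis
    unfolding lookup_fq_comul_standard csize_of_word a b map_shuffles .
qed

subsection \<open>Multiplicativity of the coproduct\<close>

lemma append_in_shuffles: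
  "u \<in> shuffles xs ys \<Longrightarrow> v \<in> shuffles xs' ys' \<Longrightarrow> u @ v \<in> shuffles (xs @ xs') (ys @ ys')"
proof (induction u arbitrary: xs ys)
  case (Cons a u)
  from Cons.prems(1) consider
      "xs \<noteq> []" "hd xs = a" "u \<in> shuffles (tl xs) ys"
    | "ys \<noteq> []" "hd ys = a" "u \<in> shuffles xs (tl ys)"
    by (auto simp: Cons_in_shuffles_iff)
  thus ?case
  proof cases
    case 1
    with Cons.IH[OF 1(3) Cons.prems(2)] show ?thesis by (simp add: Cons_in_shuffles_iff)
  next
    case 2
    with Cons.IH[OF 2(3) Cons.prems(2)] show ?thesis by (simp add: Cons_in_shuffles_iff)
  qed
qed simp

text \<open>The bijection behind multiplicativity. For a cut shuffle \<open>u @ v\<close>, filtering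
  by \<open>P\<close> shows that \<open>u\<close> shuffles a prefix of \<open>xs\<close> with a
  prefix of \<open>ys\<close>, and \<open>v\<close> shuffles the remaining suffixes; conversely such
  \<open>u\<close> and \<open>v\<close> concatenate to a shuffle.\<close>

lemma sum_shuffles_split:
  fixes F :: "'a list \<Rightarrow> 'a list \<Rightarrow> 'b::comm_monoid_add"
  assumes P: "\<And>a. a \<in> set xs \<Longrightarrow> P a" "\<And>a. a \<in> set ys \<Longrightarrow> \<not> P a"
  shows "(\<Sum>w\<in>shuffles xs ys. \<Sum>i\<le>length w. F (take i w) (drop i w)) =
    (\<Sum>j\<le>length xs. \<Sum>k\<le>length ys. \<Sum>u\<in>shuffles (take j xs) (take k ys).
       \<Sum>v\<in>shuffles (drop j xs) (drop k ys). F u v)"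
proof -
  let ?A = "\<lambda>(j, k). shuffles (take j xs) (take k ys) \<times> shuffles (drop j xs) (drop k ys)"
  \<comment> \<open>The cut positions \<open>(j, k)\<close> recovered from the left part: how many
    of its letters come from \<open>xs\<close> and how many from \<open>ys\<close>.\<close>
  let ?n = "\<lambda>u. (length (filter P u), length (filter (\<lambda>a. \<not> P a) u))"
  let ?f = "\<lambda>(u, v). (?n u, u, v)" and ?g = "\<lambda>((j, k), u, v). (u, v)"
  let ?T = "{(u, v). u @ v \<in> shuffles xs ys}"
  have "(\<Sum>w\<in>shuffles xs ys. \<Sum>i\<le>length w. F (take i w) (drop i w)) =
      (\<Sum>(w, i)\<in>(SIGMA w:shuffles xs ys. {..length w}). F (take i w) (drop i w))"
    by (rule sum.Sigma) simp_all
  also have "\<dots> = (\<Sum>(u, v)\<in>?T. F u v)"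
    by (rule sum.reindex_bij_witness[where i = "\<lambda>(u, v). (u @ v, length u)" and
          j = "\<lambda>(w, i). (take i w, drop i w)"]) auto
  also have "\<dots> = (\<Sum>((j, k), u, v)\<in>(SIGMA jk:{..length xs} \<times> {..length ys}. ?A jk). F u v)"
  proof (rule sum.reindex_bij_witness[where j = ?f and i = ?g])
    fix a assume "a \<in> ?T"
    then obtain u v where a: "a = (u, v)" and uv: "u @ v \<in> shuffles xs ys" by blast
    show "?g (?f a) = a"
      by (simp add: a)
    have xs: "filter P u @ filter P v = xs" and ys: "filter (\<lambda>a. \<not> P a) u @ filter (\<lambda>a. \<not> P a) v = ys"
      using uv shuffles_iff_filter[of xs P ys "u @ v", OF P] by simp_all
    have "(u, v) \<in> ?A (?n u)"
      unfolding xs[symmetric] ys[symmetric] by (simp add: partition_in_shuffles)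
    moreover have "length (filter P u) \<le> length xs" "length (filter (\<lambda>a. \<not> P a) u) \<le> length ys"
      unfolding xs[symmetric] ys[symmetric] by simp_all
    ultimately show "?f a \<in>
        (SIGMA jk:{..length xs} \<times> {..length ys}. ?A jk)"
      by (simp add: a)
  next
    fix b assume "b \<in> (SIGMA jk:{..length xs} \<times> {..length ys}. ?A jk)"
    then obtain j k u v where b: "b = ((j, k), u, v)" and j: "j \<le> length xs" and k: "k \<le> length ys"
      and u: "u \<in> shuffles (take j xs) (take k ys)" and v: "v \<in> shuffles (drop j xs) (drop k ys)"
      by auto
    have "filter P u = take j xs \<and> filter (\<lambda>a. \<not> P a) u = take k ys"
      using u P by (subst (asm) shuffles_iff_filter[of _ P]) (auto dest: in_set_takeD)
    thus "?f (?g b) = b"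
      using j k by (simp add: b)
    have "u @ v \<in> shuffles xs ys"
      using append_in_shuffles[OF u v] by simp
    thus "?g b \<in> ?T" by (simp add: b)
  qed auto
  also have "\<dots> = (\<Sum>jk\<in>{..length xs} \<times> {..length ys}. \<Sum>(u, v)\<in>?A jk. F u v)"
    by (subst sum.Sigma) (auto intro!: sum.cong)
  also have "\<dots> = (\<Sum>(j, k)\<in>{..length xs} \<times> {..length ys}. \<Sum>u\<in>shuffles (take j xs) (take k ys).
       \<Sum>v\<in>shuffles (drop j xs) (drop k ys). F u v)"
    by (rule sum.cong) (auto simp: sum.cartesian_product)
  also have "\<dots> = (\<Sum>j\<le>length xs. \<Sum>k\<le>length ys. \<Sum>u\<in>shuffles (take j xs) (take k ys).
       \<Sum>v\<in>shuffles (drop j xs) (drop k ys). F u v)"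
    by (simp add: sum.cartesian_product)
  finally show ?thesis .
qed

section \<open>Coefficients of products in the tensor square, and the comparison with the
  coproduct\<close>

abbreviation fq_tensor_mul where
  "fq_tensor_mul \<equiv> tensor_mul fq_mul fq_mul"

lemmas clinear_fq_tensor_mul_left = clinear_tensor_mul_left[OF unital_algebra_fq unital_algebra_fq]
lemmas clinear_fq_tensor_mul_right = clinear_tensor_mul_right[OF unital_algebra_fq unital_algebra_fq]

lemma lookup_basis_pair:
  "Poly_Mapping.lookup (basis (a, b)) (c, d) =
     Poly_Mapping.lookup (basis a) c * Poly_Mapping.lookup (basis b) d"
  by (simp add: lookup_basis)

text \<open>By bilinearity only basis vectors matter. There the product is a pure tensor, and its
  coefficient is a product of two sums over cuts.\<close>

lemma lookup_fq_tensor_mul: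
  "Poly_Mapping.lookup (fq_tensor_mul p q) (y, z) =
    (\<Sum>j\<le>csize y. \<Sum>k\<le>csize z.
       Poly_Mapping.lookup p (of_word (take j (word y)), of_word (take k (word z))) *
       Poly_Mapping.lookup q (of_word (drop j (word y)), of_word (drop k (word z))))"
proof -
  let ?l = Poly_Mapping.lookup
  let ?R = "\<lambda>p q. \<Sum>j\<le>csize y. \<Sum>k\<le>csize z.
    ?l p (of_word (take j (word y)), of_word (take k (word z))) *
    ?l q (of_word (drop j (word y)), of_word (drop k (word z)))"
  have L: "clinear_form (\<lambda>p. ?l (fq_tensor_mul p q) (y, z))"
    "clinear_form (\<lambda>q. ?l (fq_tensor_mul p q) (y, z))" for p q
    by (intro clinear_formI; simp add: lookup_add clinear_add[OF clinear_fq_tensor_mul_left]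
          clinear_smult[OF clinear_fq_tensor_mul_left] clinear_add[OF clinear_fq_tensor_mul_right]
          clinear_smult[OF clinear_fq_tensor_mul_right])+
  have R: "clinear_form (\<lambda>p. ?R p q)" "clinear_form (\<lambda>q. ?R p q)" for p q
    by (intro clinear_formI; simp add: lookup_add algebra_simps sum.distrib sum_distrib_left)+
  have bas: "?l (fq_tensor_mul (basis u) (basis v)) (y, z) = ?R (basis u) (basis v)" for u v
  proof -
    obtain a b c d where uv: "u = (a, b)" "v = (c, d)" by (metis surj_pair)
    have "?l (fq_tensor_mul (basis u) (basis v)) (y, z) =
        ?l (fq_mul (basis a) (basis c)) y * ?l (fq_mul (basis b) (basis d)) z"
      unfolding uv tensor_mul_basis[OF unital_algebra_fq unital_algebra_fq] lookup_tensor ..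
    also have "\<dots> = ?R (basis u) (basis v)"
      unfolding uv lookup_fq_mul_word[of _ _ y] lookup_fq_mul_word[of _ _ z] sum_product lookup_basis_pair
      by (intro sum.cong refl) (simp only: mult_ac)
    finally show ?thesis .
  qed
  have "?l (fq_tensor_mul (basis u) q) (y, z) = ?R (basis u) q" for u
    using L(2) R(2) bas by (rule clinear_form_eqI)
  note basis_left = this
  show ?thesis using L(1) R(1) basis_left by (rule clinear_form_eqI)
qed

lemma fq_comul_mul: "fq_comul (fq_mul p q) = fq_tensor_mul (fq_comul p) (fq_comul q)"
proof (rule poly_mapping_eqI)
  fix yz :: "'a cperm \<times> 'a cperm"
  obtain y z where yz: "yz = (y, z)" by (cases yz)
  let ?l = Poly_Mapping.lookup
  let ?a = "word y" and ?b = "shifted_word (csize y) z"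
  have less: "i < j" if "i \<in> fst ` set ?a" "j \<in> fst ` set ?b" for i j
    using that unfolding fst_set_word fst_set_shifted_word by simp
  have P: "fst x \<le> csize y" if "x \<in> set ?a" for x
    using imageI[OF that, of fst] unfolding fst_set_word by simp
  have Q: "\<not> fst x \<le> csize y" if "x \<in> set ?b" for x
    using imageI[OF that, of fst] unfolding fst_set_shifted_word by simp
  \<comment> \<open>Prefixes and suffixes of the two words are in general not standard, but they
    inherit distinct letters and the separation of \<open>?a\<close> from \<open>?b\<close>. Hence
    the general coefficient formula applies to each piece.\<close>
  have part: "?l (fq_comul r) (of_word a, of_word b) = (\<Sum>w\<in>shuffles a b. ?l r (of_word w))"
    if "a = take j ?a \<and> b = take k ?b \<or> a = drop j ?a \<and> b = drop k ?b" for r a b j k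
  proof (rule lookup_fq_comul)
    have sub: "set a \<subseteq> set ?a" "set b \<subseteq> set ?b"
      using that by (auto dest: in_set_takeD in_set_dropD simp del: set_map)
    have "distinct (map fst (take n w))" "distinct (map fst (drop n w))"
      if "distinct (map fst w)" for n and w :: "(nat \<times> 'a) list"
      using that by (simp_all flip: take_map drop_map)
    note dist = this[OF distinct_map_fst_word] this[OF distinct_map_fst_shifted_word]
    show "distinct (map fst a)" "distinct (map fst b)"
      using that by (elim disjE conjE; simp only: dist)+
    show "i < j" if "i \<in> fst ` set a" "j \<in> fst ` set b" for i j
      using that sub by (intro less) blast+
  qed
  \<comment> \<open>The shift by \<open>csize y\<close> was only needed to keep the letters apart;
    it disappears under standardization.\<close>
  have shift: "of_word (take k ?b) = of_word (take k (word z))"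
    "of_word (drop k ?b) = of_word (drop k (word z))" for k
    by (simp_all add: take_map drop_map of_word_map strict_mono_on_def)
  have "?l (fq_comul (fq_mul p q)) (y, z) =
      (\<Sum>w\<in>shuffles ?a ?b. \<Sum>i\<le>length w. ?l p (of_word (take i w)) * ?l q (of_word (drop i w)))"
    by (simp only: lookup_fq_comul_standard lookup_fq_mul)
  also have "\<dots> = (\<Sum>j\<le>length ?a. \<Sum>k\<le>length ?b. \<Sum>u\<in>shuffles (take j ?a) (take k ?b).
       \<Sum>v\<in>shuffles (drop j ?a) (drop k ?b). ?l p (of_word u) * ?l q (of_word v))"
    by (rule sum_shuffles_split[where P = "\<lambda>x. fst x \<le> csize y"]) (rule P, assumption, rule Q)
  also have "\<dots> = (\<Sum>j\<le>csize y. \<Sum>k\<le>csize z.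
       ?l (fq_comul p) (of_word (take j ?a), of_word (take k ?b)) *
       ?l (fq_comul q) (of_word (drop j ?a), of_word (drop k ?b)))"
    by (simp only: part[of "take j ?a" j "take k ?b" k for j k] part[of "drop j ?a" j "drop k ?b" k for j k]
          simp_thms sum_product length_map length_word)
  also have "\<dots> = ?l (fq_tensor_mul (fq_comul p) (fq_comul q)) (y, z)"
    unfolding lookup_fq_tensor_mul shift ..
  finally show "?l (fq_comul (fq_mul p q)) yz = ?l (fq_tensor_mul (fq_comul p) (fq_comul q)) yz"
    by (simp only: yz)
qed

lemma fq_comul_unit: "fq_comul fq_unit = fq_unit \<otimes> fq_unit"
proof -
  have "csize (seg (of_word [] :: 'a cperm) 0 0) = 0"
    using word_seg(2)[of 0 0 "of_word []"] by simp
  hence "seg (of_word [] :: 'a cperm) 0 0 = of_word []" by (simp only: csize_eq_0_iff)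
  thus ?thesis by (simp add: fq_unit_eq fq_comul_basis)
qed

lemma algebra_hom_fq_comul:
  "algebra_hom fq_mul fq_unit fq_tensor_mul (fq_unit \<otimes> fq_unit) fq_comul"
  by (intro algebra_hom.intro algebra_hom_axioms.intro unital_algebra_fq unital_algebra_tensor
      clinear_fq_comul fq_comul_mul fq_comul_unit)

subsection \<open>The graded bialgebra structure\<close>

lemma seg_length_0: "k \<le> csize x \<Longrightarrow> seg x k k = of_word []"
  using word_seg(2)[of k k x] by (simp add: csize_eq_0_iff)

lemma fq_comul_seg:
  assumes "k \<le> m" "m \<le> csize x"
  shows "fq_comul (basis (seg x k m)) =
    (\<Sum>i\<le>m - k. basis (seg x k (k + i), seg x (k + i) m))"
  using assms by (simp add: fq_comul_basis word_seg(2) seg_seg)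

lemma clinear_tensor_assoc: "clinear tensor_assoc"
  unfolding tensor_assoc_def by (rule clinear_linext)

lemma tensor_assoc_tensor_basis:
  "tensor_assoc (p \<otimes> basis c) = linext (\<lambda>(a, b). basis (a, b, c)) p"
  by (rule clinear_eqI[OF clinear_compose[OF clinear_tensor_assoc clinear_tensor_left] clinear_linext])
     (auto simp: tensor_assoc_def)

text \<open>Both sides sum over two successive cuts of the values of \<open>x\<close> into three
  segments, indexed either by the outer cut first or by the inner one.\<close>

lemma fq_comul_coassoc:
  "tensor_assoc (tensor_map fq_comul id (fq_comul p)) = tensor_map id fq_comul (fq_comul p)"
proof (rule clinear_eqI[OF clinear_compose[OF clinear_tensor_assoc
        clinear_compose[OF clinear_tensor_map clinear_fq_comul]]
        clinear_compose[OF clinear_tensor_map clinear_fq_comul]])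
  fix x :: "'a cperm"
  let ?n = "csize x"
  have "tensor_assoc (tensor_map fq_comul id (fq_comul (basis x))) =
      (\<Sum>i\<le>?n. \<Sum>j\<le>i. basis (seg x 0 j, seg x j i, seg x i ?n))"
    by (simp add: fq_comul_basis[of x] clinear_sum[OF clinear_tensor_map] tensor_map_basis
        clinear_sum[OF clinear_tensor_assoc] tensor_assoc_tensor_basis fq_comul_seg
        clinear_sum[OF clinear_linext])
  also have "\<dots> = (\<Sum>j\<le>?n. \<Sum>k\<le>?n - j. basis (seg x 0 j, seg x j (j + k), seg x (j + k) ?n))"
    by (rule sum_triangle_assoc)
  also have "\<dots> = tensor_map id fq_comul (fq_comul (basis x))"
    by (simp add: fq_comul_basis[of x] clinear_sum[OF clinear_tensor_map] tensor_map_basis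
        fq_comul_seg clinear_sum[OF clinear_tensor_right])
  finally show "tensor_assoc (tensor_map fq_comul id (fq_comul (basis x))) =
      tensor_map id fq_comul (fq_comul (basis x))" .
qed

lemma fq_counit_basis: "fq_counit (basis x) = (if csize x = 0 then 1 else 0)"
  by (simp add: fq_counit_eq lookup_basis csize_eq_0_iff)

lemma clinear_form_fq_counit: "clinear_form fq_counit"
  unfolding fq_counit_eq by (rule clinear_lookup)

lemma fq_counit_left: "lunit_map fq_counit (fq_comul p) = p"
proof (rule clinear_eqI[OF clinear_compose[OF _ clinear_fq_comul] clinear_id(1)])
  show lin: "clinear (lunit_map fq_counit)"
    unfolding lunit_map_def by (rule clinear_linext)
  fix x :: "'a cperm"
  \<comment> \<open>The counit kills every nonempty left segment, so only the cut at 0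
    survives.\<close>
  have "lunit_map fq_counit (fq_comul (basis x)) =
      (\<Sum>i\<le>csize x. if i = 0 then basis x else 0)"
    unfolding fq_comul_basis clinear_sum[OF lin]
    by (rule sum.cong[OF refl])
       (auto simp: lunit_map_def fq_counit_basis word_seg(2) seg_full[simplified])
  thus "lunit_map fq_counit (fq_comul (basis x)) = basis x" by simp
qed

lemma fq_counit_right: "runit_map fq_counit (fq_comul p) = p"
proof (rule clinear_eqI[OF clinear_compose[OF _ clinear_fq_comul] clinear_id(1)])
  show lin: "clinear (runit_map fq_counit)"
    unfolding runit_map_def by (rule clinear_linext)
  fix x :: "'a cperm"
  have "runit_map fq_counit (fq_comul (basis x)) =
      (\<Sum>i\<le>csize x. if i = csize x then basis x else 0)"
    unfolding fq_comul_basis clinear_sum[OF lin]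
    by (rule sum.cong[OF refl])
       (auto simp: runit_map_def fq_counit_basis word_seg(2) seg_full[simplified])
  thus "runit_map fq_counit (fq_comul (basis x)) = basis x" by simp
qed

lemma bialgebra_fq: "bialgebra fq_mul fq_unit fq_comul fq_counit"
proof (intro bialgebra.intro bialgebra_axioms.intro counital_coalgebra.intro)
  \<comment> \<open>The counit is the coefficient at the empty word, which has a single cut.\<close>
  show "fq_counit (fq_mul p q) = fq_counit p * fq_counit q" for p q :: "'a fqsym"
    by (simp add: fq_counit_eq lookup_fq_mul)
  show "fq_counit (fq_unit :: 'a fqsym) = 1"
    by (simp add: fq_counit_eq lookup_fq_unit)
qed (rule unital_algebra_fq clinear_fq_comul clinear_form_fq_counit fq_comul_coassoc
       fq_counit_left fq_counit_right algebra_hom_fq_comul)+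

section \<open>The grading by size, described through supports\<close>

lemma fq_grade_iff: "p \<in> fq_grade n \<longleftrightarrow> (\<forall>x. Poly_Mapping.lookup p x \<noteq> 0 \<longrightarrow> csize x = n)"
proof
  have "fq_grade n \<subseteq> {p :: 'a fqsym. \<forall>x. Poly_Mapping.lookup p x \<noteq> 0 \<longrightarrow> csize x = n}"
    unfolding fq_grade_def
  proof (rule smult.span_minimal)
    show "smult.subspace {p :: 'a fqsym. \<forall>x. Poly_Mapping.lookup p x \<noteq> 0 \<longrightarrow> csize x = n}"
      unfolding smult.subspace_def mem_Collect_eq Ball_def
      by (metis lookup_zero lookup_add lookup_smult add_0 mult_zero_right)
  qed (auto simp: lookup_basis split: if_splits)
  thus "p \<in> fq_grade n \<Longrightarrow> \<forall>x. Poly_Mapping.lookup p x \<noteq> 0 \<longrightarrow> csize x = n" by blast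
  assume "\<forall>x. Poly_Mapping.lookup p x \<noteq> 0 \<longrightarrow> csize x = n"
  thus "p \<in> fq_grade n"
    unfolding fq_grade_def
    by (subst basis_expansion[of p], intro smult.span_sum smult.span_scale smult.span_base)
       (auto simp: in_keys_iff)
qed

lemma basis_in_fq_grade: "basis x \<in> fq_grade (csize x)"
  by (auto simp: fq_grade_iff lookup_basis split: if_splits)

lemma fq_grade_direct_sum:
  fixes p :: "'c fqsym"
  shows "\<exists>!f. (\<forall>n. f n \<in> fq_grade n) \<and> finite {n. f n \<noteq> 0} \<and> p = (\<Sum>n | f n \<noteq> 0. f n)"
proof (rule ex1I, intro conjI allI)
  let ?l = Poly_Mapping.lookup
  \<comment> \<open>The component of degree \<open>n\<close> collects the terms of \<open>p\<close>
    of size \<open>n\<close>.\<close>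
  define f where "f n = linext (\<lambda>x. if csize x = n then basis x else 0) p" for n
  have lookup_f: "?l (f n) x = (if csize x = n then ?l p x else 0)" for n x
  proof -
    have "?l (f n) x = (\<Sum>a\<in>Poly_Mapping.keys p. if a = x then if csize x = n then ?l p x else 0 else 0)"
      unfolding f_def linext_def lookup_sum by (rule sum.cong) (auto simp: lookup_basis)
    thus ?thesis by (simp add: in_keys_iff)
  qed
  show "f n \<in> fq_grade n" for n by (simp add: fq_grade_iff lookup_f)
  have sub: "n \<in> csize ` Poly_Mapping.keys p" if nonzero: "f n \<noteq> 0" for n
  proof -
    obtain x where "?l (f n) x \<noteq> 0" using nonzero poly_mapping_eqI[of "f n" 0] by auto
    thus ?thesis by (auto simp: lookup_f in_keys_iff split: if_splits)
  qed
  show fin: "finite {n. f n \<noteq> 0}"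
    by (rule finite_subset[of _ "csize ` Poly_Mapping.keys p"]) (use sub in auto)
  \<comment> \<open>In any homogeneous decomposition the coefficient at \<open>x\<close> comes only
    from degree \<open>csize x\<close>. This gives both existence and uniqueness.\<close>
  have pick: "?l (\<Sum>n | g n \<noteq> 0. g n) x = ?l (g (csize x)) x"
    if "\<forall>n. g n \<in> fq_grade n" "finite {n. g n \<noteq> 0}" for g and x :: "'c cperm"
  proof -
    have "?l (\<Sum>n | g n \<noteq> 0. g n) x =
        (\<Sum>n | g n \<noteq> 0. if n = csize x then ?l (g (csize x)) x else 0)"
      unfolding lookup_sum
    proof (rule sum.cong[OF refl])
      fix n
      show "?l (g n) x = (if n = csize x then ?l (g (csize x)) x else 0)"
        using that(1) by (cases "n = csize x") (auto simp: fq_grade_iff)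
    qed
    thus ?thesis using that(2) by (simp add: sum.delta)
  qed
  show "p = (\<Sum>n | f n \<noteq> 0. f n)"
    by (rule poly_mapping_eqI) (subst pick; simp add: fin lookup_f fq_grade_iff)
  fix g
  assume g: "(\<forall>n. g n \<in> fq_grade n) \<and> finite {n. g n \<noteq> 0} \<and> p = (\<Sum>n | g n \<noteq> 0. g n)"
  hence "?l p x = ?l (g (csize x)) x" for x using pick[of g x] by metis
  moreover have "?l (g n) x = 0" if "csize x \<noteq> n" for n x
    using g that by (auto simp: fq_grade_iff)
  ultimately show "g = f" by (intro ext poly_mapping_eqI) (auto simp: lookup_f)
qed

lemma fq_grade_mul:
  assumes "p \<in> fq_grade m" "q \<in> fq_grade n"
  shows "fq_mul p q \<in> fq_grade (m + n)"
  unfolding fq_grade_iff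
proof (intro allI impI)
  fix x assume "Poly_Mapping.lookup (fq_mul p q) x \<noteq> 0"
  then obtain i where "i \<le> csize x" "Poly_Mapping.lookup p (of_word (take i (word x))) \<noteq> 0"
    "Poly_Mapping.lookup q (of_word (drop i (word x))) \<noteq> 0"
    unfolding lookup_fq_mul_word by (metis (no_types, lifting) atMost_iff mult_eq_0_iff sum.neutral)
  moreover from this have "csize (of_word (take i (word x))) = m" "csize (of_word (drop i (word x))) = n"
    using assms unfolding fq_grade_iff by blast+
  ultimately show "csize x = m + n" by simp
qed

text \<open>A cut at \<open>i\<close> leaves segments of sizes \<open>i\<close> and
  \<open>n - i\<close>, so each summand on a basis vector of size \<open>n\<close> is a tensor of
  homogeneous elements.\<close>

lemma fq_grade_comul:
  assumes "p \<in> fq_grade n"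
  shows "fq_comul p \<in>
    smult.span {y \<otimes> z |y z. \<exists>i j. i + j = n \<and> y \<in> fq_grade i \<and> z \<in> fq_grade j}"
proof -
  have "basis (seg x 0 i, seg x i (csize x)) \<in>
      {y \<otimes> z |y z. \<exists>i j. i + j = n \<and> y \<in> fq_grade i \<and> z \<in> fq_grade j}"
    if "i \<le> csize x" "csize x = n" for i and x :: "'a cperm"
  proof -
    have "basis (seg x 0 i) \<in> fq_grade i" "basis (seg x i (csize x)) \<in> fq_grade (n - i)"
      using basis_in_fq_grade[of "seg x 0 i"] basis_in_fq_grade[of "seg x i (csize x)"] that
      by (simp_all add: word_seg(2))
    moreover have "i + (n - i) = n" using that by simp
    ultimately show ?thesis by (metis (mono_tags, lifting) mem_Collect_eq tensor_basis)
  qed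
  hence on_basis: "fq_comul (basis x) \<in>
      smult.span {y \<otimes> z |y z. \<exists>i j. i + j = n \<and> y \<in> fq_grade i \<and> z \<in> fq_grade j}"
    if "csize x = n" for x :: "'a cperm"
    unfolding fq_comul_basis using that by (intro smult.span_sum smult.span_base) simp
  show ?thesis
    unfolding clinear_expansion[OF clinear_fq_comul, of p] linext_def
    by (intro smult.span_sum smult.span_scale on_basis)
       (use assms in \<open>simp add: fq_grade_iff in_keys_iff\<close>)
qed

lemma graded_bialgebra_fq: "graded_bialgebra fq_mul fq_unit fq_comul fq_counit fq_grade"
proof (intro graded_bialgebra.intro graded_bialgebra_axioms.intro)
  show "smult.subspace (fq_grade n :: 'a fqsym set)" for n
    unfolding fq_grade_def by (rule smult.subspace_span)
  show "(fq_unit :: 'a fqsym) \<in> fq_grade 0"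
    using basis_in_fq_grade[of "of_word []"] by (simp add: fq_unit_eq)
  show "fq_counit p = 0" if "n > 0" "p \<in> fq_grade n" for n and p :: "'a fqsym"
    using that by (force simp: fq_grade_iff fq_counit_eq)
qed (rule bialgebra_fq fq_grade_direct_sum fq_grade_mul fq_grade_comul; assumption?)+


subsection \<open>The antipode\<close>

text \<open>
  In a connected graded bialgebra, the identity has a left and a right convolution inverse, both
  given by recursion on the degree; associativity of convolution forces them to agree.
\<close>

function left_antipode :: "'c cperm \<Rightarrow> 'c fqsym" where
  "left_antipode x = (if csize x = 0 then fq_unit else
     - (\<Sum>i<csize x. fq_mul (left_antipode (seg x 0 i)) (basis (seg x i (csize x)))))"
  by auto
termination
  by (relation "measure csize") (auto simp: word_seg(2))

text \<open>The index is shifted by \<open>Suc\<close> so that the left segment is never empty and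
  the recursive call is on a smaller segment. The omitted cut at 0 would contribute
  \<open>right_antipode x\<close> itself.\<close>

function right_antipode :: "'c cperm \<Rightarrow> 'c fqsym" where
  "right_antipode x = (if csize x = 0 then fq_unit else
     - (\<Sum>i<csize x. fq_mul (basis (seg x 0 (Suc i))) (right_antipode (seg x (Suc i) (csize x)))))"
  by auto
termination
  by (relation "measure csize") (auto simp: word_seg(2))

declare left_antipode.simps [simp del] right_antipode.simps [simp del]

text \<open>The left inverse property on a basis vector. For nonempty \<open>x\<close> the last cut
  has an empty right segment and contributes \<open>left_antipode x\<close>, which by the recursion
  cancels the other terms.\<close>

lemma left_antipode_conv:
  "(\<Sum>i\<le>csize x. fq_mul (left_antipode (seg x 0 i)) (basis (seg x i (csize x)))) =
     (if csize x = 0 then fq_unit else 0)"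
proof (cases "csize x = 0")
  case True
  hence x: "x = of_word []" by (simp only: csize_eq_0_iff)
  have "seg x 0 0 = of_word []" using seg_length_0[of 0 x] by simp
  thus ?thesis
    by (simp add: x left_antipode.simps[of "of_word []"] fq_mul_unit_left flip: fq_unit_eq)
next
  case False
  thus ?thesis
    using left_antipode.simps[of x] seg_full[of x] seg_length_0[of "csize x" x]
    by (simp add: fq_mul_unit_right flip: lessThan_Suc_atMost fq_unit_eq)
qed

lemma right_antipode_conv:
  "(\<Sum>i\<le>csize x. fq_mul (basis (seg x 0 i)) (right_antipode (seg x i (csize x)))) =
     (if csize x = 0 then fq_unit else 0)"
proof (cases "csize x = 0")
  case True
  hence x: "x = of_word []" by (simp only: csize_eq_0_iff)
  have "seg x 0 0 = of_word []" using seg_length_0[of 0 x] by simp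
  thus ?thesis
    by (simp add: x right_antipode.simps[of "of_word []"] fq_mul_unit_left flip: fq_unit_eq)
next
  case False
  have "(\<Sum>i\<le>csize x. fq_mul (basis (seg x 0 i)) (right_antipode (seg x i (csize x)))) =
      fq_mul (basis (seg x 0 0)) (right_antipode (seg x 0 (csize x))) +
      (\<Sum>i<csize x. fq_mul (basis (seg x 0 (Suc i))) (right_antipode (seg x (Suc i) (csize x))))"
    by (rule sum.atMost_shift)
  also have "\<dots> = 0"
    using False right_antipode.simps[of x] seg_full[of x] seg_length_0[of 0 x]
    by (simp add: fq_mul_unit_left flip: fq_unit_eq)
  finally show ?thesis using False by simp
qed

text \<open>With \<open>*\<close> for convolution, \<open>S\<close> the left inverse and
  \<open>T\<close> the right inverse, \<open>T = (S * id) * T = S * (id * T) = S\<close>. The middle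
  equality is the reindexing of sums over two cuts.\<close>

lemma left_antipode_eq_right: "left_antipode x = right_antipode x"
proof -
  let ?n = "csize x" and ?S = left_antipode and ?T = right_antipode
  let ?t = "\<lambda>j i. fq_mul (fq_mul (?S (seg x 0 j)) (basis (seg x j i))) (?T (seg x i ?n))"
  \<comment> \<open>Grouping by the second cut \<open>i\<close>, the inner sum is the left inverse
    identity for the segment from 0 to \<open>i\<close>, which vanishes unless
    \<open>i = 0\<close>.\<close>
  have "(\<Sum>i\<le>?n. \<Sum>j\<le>i. ?t j i) = (\<Sum>i\<le>?n. if i = 0 then ?T x else 0)"
  proof (rule sum.cong[OF refl])
    fix i assume i: "i \<in> {..?n}"
    have "(\<Sum>j\<le>i. ?t j i) =
        fq_mul (\<Sum>j\<le>i. fq_mul (?S (seg x 0 j)) (basis (seg x j i))) (?T (seg x i ?n))"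
      by (simp add: clinear_sum[OF clinear_fq_mul_left])
    also have "(\<Sum>j\<le>i. fq_mul (?S (seg x 0 j)) (basis (seg x j i))) = (if i = 0 then fq_unit else 0)"
      using left_antipode_conv[of "seg x 0 i"] i by (simp add: word_seg(2) seg_seg)
    also have "fq_mul \<dots> (?T (seg x i ?n)) = (if i = 0 then ?T x else 0)"
      using seg_full[of x] by (simp add: fq_mul_unit_left clinear_zero[OF clinear_fq_mul_left])
    finally show "(\<Sum>j\<le>i. ?t j i) = (if i = 0 then ?T x else 0)" .
  qed
  hence "(\<Sum>i\<le>?n. \<Sum>j\<le>i. ?t j i) = ?T x" by simp
  moreover have "(\<Sum>i\<le>?n. \<Sum>j\<le>i. ?t j i) = (\<Sum>j\<le>?n. \<Sum>k\<le>?n - j. ?t j (j + k))"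
    by (rule sum_triangle_assoc)
  \<comment> \<open>Grouping by the first cut \<open>j\<close>, the inner sum is the right inverse
    identity for the segment from \<open>j\<close> to \<open>?n\<close>, which vanishes unless that
    segment is empty.\<close>
  moreover have "\<dots> = (\<Sum>j\<le>?n. if j = ?n then ?S x else 0)"
  proof (rule sum.cong[OF refl])
    fix j assume j: "j \<in> {..?n}"
    have "(\<Sum>k\<le>?n - j. ?t j (j + k)) = fq_mul (?S (seg x 0 j))
        (\<Sum>k\<le>?n - j. fq_mul (basis (seg x j (j + k))) (?T (seg x (j + k) ?n)))"
      by (simp add: clinear_sum[OF clinear_fq_mul_right] fq_mul_assoc)
    also have "(\<Sum>k\<le>?n - j. fq_mul (basis (seg x j (j + k))) (?T (seg x (j + k) ?n))) =
        (if j = ?n then fq_unit else 0)"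
      using right_antipode_conv[of "seg x j ?n"] j by (simp add: word_seg(2) seg_seg)
    also have "fq_mul (?S (seg x 0 j)) \<dots> = (if j = ?n then ?S x else 0)"
      using seg_full[of x] by (simp add: fq_mul_unit_right clinear_zero[OF clinear_fq_mul_right])
    finally show "(\<Sum>k\<le>?n - j. ?t j (j + k)) = (if j = ?n then ?S x else 0)" .
  qed
  ultimately show ?thesis by simp
qed

lemma hopf_algebra_fq: "hopf_algebra fq_mul fq_unit fq_comul (fq_counit :: 'c fqsym \<Rightarrow> complex)"
proof (intro hopf_algebra.intro hopf_algebra_axioms.intro bialgebra_fq exI conjI allI)
  let ?S = "linext left_antipode :: 'c fqsym \<Rightarrow> 'c fqsym"
  show "clinear ?S" by (rule clinear_linext)
  have rhs: "clinear (\<lambda>p. smult (fq_counit p) fq_unit)"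
    by (intro clinearI) (simp_all add: clinear_formD[OF clinear_form_fq_counit] smult_add_left)
  have lhs: "clinear (\<lambda>p. mul_map fq_mul (tensor_map f g (fq_comul p)))" for f g
    by (rule clinear_compose[OF clinear_mul_map clinear_compose[OF clinear_tensor_map clinear_fq_comul]])
  \<comment> \<open>The convolution of \<open>f\<close> and \<open>g\<close> at a basis vector is a
    sum over cuts, the form in which the two inverse identities are stated.\<close>
  have expand: "mul_map fq_mul (tensor_map f g (fq_comul (basis x))) =
      (\<Sum>i\<le>csize x. fq_mul (f (basis (seg x 0 i))) (g (basis (seg x i (csize x)))))"
    for f g and x :: "'c cperm"
    by (simp add: fq_comul_basis clinear_sum[OF clinear_tensor_map] tensor_map_basis
        clinear_sum[OF clinear_mul_map] mul_map_tensor[OF clinear_fq_mul_left clinear_fq_mul_right])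
  show "mul_map fq_mul (tensor_map ?S id (fq_comul p)) = smult (fq_counit p) fq_unit" for p
    by (rule clinear_eqI[OF lhs rhs]) (simp add: expand left_antipode_conv fq_counit_basis)
  show "mul_map fq_mul (tensor_map id ?S (fq_comul p)) = smult (fq_counit p) fq_unit" for p
    by (rule clinear_eqI[OF lhs rhs])
       (simp add: expand left_antipode_eq_right right_antipode_conv fq_counit_basis)
qed

theorem theorem2p3:
  shows "algebra_hom fq_mul fq_unit (tensor_mul fq_mul fq_mul) (fq_unit \<otimes> fq_unit)
           (fq_comul :: 'c::finite fqsym \<Rightarrow> ('c cperm \<times> 'c cperm \<Rightarrow>\<^sub>0 complex))
       \<and> graded_bialgebra (fq_mul :: 'c fqsym \<Rightarrow> 'c fqsym \<Rightarrow> 'c fqsym)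
           fq_unit fq_comul fq_counit fq_grade
       \<and> hopf_algebra (fq_mul :: 'c fqsym \<Rightarrow> 'c fqsym \<Rightarrow> 'c fqsym)
           fq_unit fq_comul fq_counit"
  by (intro conjI algebra_hom_fq_comul graded_bialgebra_fq hopf_algebra_fq)

end
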